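(* Let $n,k,t,s$ be positive integers with $k\geq t+2$ and $n\geq (t+1)^{2}\left(2(k-t+1)^{2}+7s\right)$. Suppose that $\mathcal{F},\mathcal{G}\subseteq\binom{[n]}{k}$ are $s$-almost cross-$t$-intersecting but not cross-$t$-intersecting families with $|\mathcal{F}|\leq|\mathcal{G}|$, and that $|\mathcal{F}||\mathcal{G}|$ is maximum among all such pairs. Then there exist $X\in\binom{[n]}{k+1}$ and $W\in\binom{X}{t}$ such that $$\mathcal{F}=\mathcal{H}_1([n],W;k)\setminus\mathcal{A}\quad\text{and}\quad \mathcal{G}=\mathcal{H}_1([n],W;k)\cup\mathcal{B},$$ where $\mathcal{A}$ is a subset of $\mathcal{H}_2(X,W;k)$ of size $\binom{n-k-1}{k-t}-s$, and $\mathcal{B}$ is a subset of $\binom{X}{k}\setminus\mathcal{H}_1(X,W;k)$ of size $\min\{t,s\}$.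
   Context: $[n]=\{1,\dots,n\}$ and $\binom{X}{k}$ denotes the family of all $k$-subsets of a set $X$. Two sets $F,G$ are $t$-intersecting if $|F\cap G|\geq t$ and $t$-disjoint otherwise. Families $\mathcal{F},\mathcal{G}$ are cross-$t$-intersecting if every member of $\mathcal{F}$ and every member of $\mathcal{G}$ are $t$-intersecting; they are $s$-almost cross-$t$-intersecting if each member of $\mathcal{F}$ is $t$-disjoint with at most $s$ members of $\mathcal{G}$ and each member of $\mathcal{G}$ is $t$-disjoint with at most $s$ members of $\mathcal{F}$. For $W\subseteq X\subseteq[n]$: $\mathcal{H}_1(X,W;k)=\{F\in\binom{X}{k}: W\subseteq F\}$ and $\mathcal{H}_2(X,W;k)=\{F\in\binom{[n]}{k}: F\cap X=W\}$. *)

theory Defs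
  imports "HOL-Library.Ramsey"
begin

text \<open>
  The family of all \<open>k\<close>-subsets of \<open>X\<close> is \<^term>\<open>nsets X k\<close>, and \<open>[n]\<close> is \<open>{1..n}\<close>.
  All sets and families below are meant to be finite, since they are measured by \<^const>\<open>card\<close>,
  which is \<open>0\<close> on infinite sets.
\<close>

definition t_intersecting :: "nat \<Rightarrow> 'a set \<Rightarrow> 'a set \<Rightarrow> bool" where
  "t_intersecting t F G \<longleftrightarrow> card (F \<inter> G) \<ge> t"

definition t_disjoint :: "nat \<Rightarrow> 'a set \<Rightarrow> 'a set \<Rightarrow> bool" where
  "t_disjoint t F G \<longleftrightarrow> \<not> t_intersecting t F G"

definition cross_t_intersecting :: "nat \<Rightarrow> 'a set set \<Rightarrow> 'a set set \<Rightarrow> bool" where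
  "cross_t_intersecting t \<F> \<G> \<longleftrightarrow> (\<forall>F\<in>\<F>. \<forall>G\<in>\<G>. t_intersecting t F G)"

definition almost_cross_t_intersecting :: "nat \<Rightarrow> nat \<Rightarrow> 'a set set \<Rightarrow> 'a set set \<Rightarrow> bool" where
  "almost_cross_t_intersecting s t \<F> \<G> \<longleftrightarrow>
     (\<forall>F\<in>\<F>. card {G\<in>\<G>. t_disjoint t F G} \<le> s) \<and>
     (\<forall>G\<in>\<G>. card {F\<in>\<F>. t_disjoint t F G} \<le> s)"

definition H1 :: "'a set \<Rightarrow> 'a set \<Rightarrow> nat \<Rightarrow> 'a set set" where
  "H1 X W k = {F \<in> nsets X k. W \<subseteq> F}"

text \<open>Unlike \<open>H1\<close>, the members of \<open>H2\<close> range over the whole ground set \<open>[n]\<close>.\<close>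

definition H2 :: "nat \<Rightarrow> nat set \<Rightarrow> nat set \<Rightarrow> nat \<Rightarrow> nat set set" where
  "H2 n X W k = {F \<in> nsets {1..n} k. F \<inter> X = W}"

text \<open>The pairs among which \<open>|\<F>||\<G>|\<close> is maximised.\<close>

definition admissible_pair ::
    "nat \<Rightarrow> nat \<Rightarrow> nat \<Rightarrow> nat \<Rightarrow> nat set set \<Rightarrow> nat set set \<Rightarrow> bool" where
  "admissible_pair n k t s \<F> \<G> \<longleftrightarrow>
     \<F> \<subseteq> nsets {1..n} k \<and> \<G> \<subseteq> nsets {1..n} k \<and>
     almost_cross_t_intersecting s t \<F> \<G> \<and> \<not> cross_t_intersecting t \<F> \<G> \<and>
     card \<F> \<le> card \<G>"

end

theory Submission
  imports Defs
begin

text \<open>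
  Put \<open>m = k - t\<close>, \<open>N = C(n-t, m)\<close> and \<open>Q = C(n-t-1, m-1)\<close>. The extremal pair has product about
  \<open>(m+1) Q N\<close>. Let \<open>t + a\<close> and \<open>t + b\<close> be the least sizes, at least \<open>t\<close>, of sets that \<open>t\<close>-intersect all but \<open>s\<close>
  members of \<open>\<F>\<close> and of \<open>\<G>\<close>, respectively. A set that does not \<open>t\<close>-intersect some member of \<open>\<F>\<close>
  extends in only \<open>m + 1\<close> ways to nearly all members of \<open>\<G>\<close> containing it, so
  \<open>|\<F>| \<le> (t+1)^a U(b)\<close> and \<open>|\<G>| \<le> (t+1)^b U(a)\<close>, where \<open>U\<close> decreases by a factor \<open>2(t+1)^2\<close> at each step.
  Maximality and \<open>|\<F>| \<le> |\<G>|\<close> then leave only \<open>a = 0\<close>, \<open>b \<le> 1\<close>, and in this case all members of \<open>\<F>\<close>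
  contain a common \<open>t\<close>-set \<open>W\<close>.

  Every \<open>(m+1)\<close>-subset of \<open>G - W\<close>, for \<open>G \<in> \<G>\<close> not containing \<open>W\<close>, meets all but \<open>s\<close> members of \<open>\<F>\<close>.
  Two different such subsets cost \<open>|\<F>|\<close> about \<open>Q\<close>, i.e. a fraction \<open>1/(m+1)\<close>, which outweighs what
  the members not containing \<open>W\<close> can add to \<open>|\<G>|\<close>. Hence all these \<open>G\<close> lie in one set \<open>X\<close> of
  size \<open>k + 1\<close>, and comparison with the extremal pair forces equality.
\<close>

subsection \<open>Binomial coefficients\<close>

lemma binomial_ge_lower:
  assumes "0 < p" "p \<le> y" shows "p \<le> y choose (p - 1)"
proof -
  have "p = p choose (p - 1)"
    using assms by (metis binomial_symmetric choose_one diff_diff_cancel diff_le_self less_eq_Suc_le One_nat_def)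
  also have "\<dots> \<le> y choose (p - 1)"
    using assms by (intro binomial_right_mono) auto
  finally show ?thesis .
qed

lemma binomial_ge_upper:
  assumes "0 < p" "p < x" shows "x \<le> x choose p"
proof -
  have "p * x \<le> x * ((x - 1) choose (p - 1))"
    using binomial_ge_lower[of p "x - 1"] assms by (simp add: mult.commute)
  also have "\<dots> = p * (x choose p)"
    using assms by (simp add: times_binomial_minus1_eq)
  finally show ?thesis using assms by simp
qed

text \<open>Pascal's rule telescopes over \<open>r\<close> steps, and the last increment is the
  largest one. Bounding by the first increment instead gives
  \<open>binomial_add_lower\<close>.\<close>

lemma binomial_add_upper:
  "0 < p \<Longrightarrow> (x + r) choose p \<le> (x choose p) + r * ((x + r - 1) choose (p - 1))"
proof (induction r)
  case (Suc r)
  have "(x + Suc r) choose p = ((x + r) choose p) + ((x + r) choose (p - 1))"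
    using Suc.prems by (cases p) auto
  moreover have "r * ((x + r - 1) choose (p - 1)) \<le> r * ((x + r) choose (p - 1))"
    by (intro mult_le_mono binomial_right_mono) auto
  moreover have "(x + r) choose p \<le> (x choose p) + r * ((x + r - 1) choose (p - 1))"
    by (rule Suc.IH[OF Suc.prems])
  ultimately have "(x + Suc r) choose p \<le> (x choose p) + r * ((x + r) choose (p - 1)) + ((x + r) choose (p - 1))"
    by linarith
  then show ?case by simp
qed simp

lemma binomial_add_lower:
  "0 < p \<Longrightarrow> (x choose p) + r * (x choose (p - 1)) \<le> (x + r) choose p"
proof (induction r)
  case (Suc r)
  have "(x + Suc r) choose p = ((x + r) choose p) + ((x + r) choose (p - 1))"
    using Suc.prems by (cases p) auto
  moreover have "x choose (p - 1) \<le> (x + r) choose (p - 1)"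
    by (intro binomial_right_mono) auto
  ultimately show ?case using Suc by simp
qed simp

text \<open>Passing from \<open>a\<close> to \<open>a + 1\<close> multiplies the binomial by (t + a
  + 1) / (a + 1), which is at most t + 1.\<close>

lemma binomial_add_le_power: "(t + a) choose t \<le> (t + 1) ^ a"
proof (induction a)
  case (Suc a)
  have "Suc a * ((t + Suc a) choose t) = (t + Suc a) * ((t + a) choose t)"
    using Suc_times_binomial[of a "t + a"] binomial_symmetric[of t "t + a"] binomial_symmetric[of t "t + Suc a"]
    by simp
  also have "\<dots> \<le> (Suc a * (t + 1)) * (t + 1) ^ a"
    using Suc by (intro mult_le_mono) auto
  finally have "Suc a * ((t + Suc a) choose t) \<le> Suc a * (t + 1) ^ Suc a"
    by (simp only: mult.assoc power_Suc)
  then show ?case by (simp only: Suc_mult_le_cancel1)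
qed simp

text \<open>The sum is the geometric sum of \<open>card_superfamily_growth\<close>; the extra 1
  stands for the \<open>s\<close> exceptions of \<open>card_le_of_almost_cover\<close>. Together
  they fit into one term of \<open>U\<close>.\<close>

lemma sum_power_le:
  fixes x :: nat
  assumes "2 \<le> x" "0 < b" shows "1 + (\<Sum>i<b. x ^ i) \<le> 2 * x ^ (b - 1)"
proof -
  have "1 + (\<Sum>i<Suc c. x ^ i) \<le> 2 * x ^ c" for c
  proof (induction c)
    case (Suc c)
    have "2 * x ^ c \<le> x * x ^ c" using assms by (intro mult_le_mono) auto
    moreover have "1 + (\<Sum>i<Suc (Suc c). x ^ i) = (1 + (\<Sum>i<Suc c. x ^ i)) + x * x ^ c" by simp
    ultimately show ?case using Suc unfolding power_Suc by linarith
  qed simp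
  from this[of "b - 1"] show ?thesis using assms by simp
qed

subsection \<open>Families of sets\<close>

lemma card_H1:
  assumes "finite X" "W \<subseteq> X" "card W \<le> k"
  shows "card (H1 X W k) = (card X - card W) choose (k - card W)"
proof -
  have fin: "finite W" using assms finite_subset by blast
  have "bij_betw (\<lambda>F. F - W) (H1 X W k) {B. B \<subseteq> X - W \<and> card B = k - card W}"
  proof (rule bij_betw_byWitness[where f' = "\<lambda>B. B \<union> W"])
    show "(\<lambda>F. F - W) ` H1 X W k \<subseteq> {B. B \<subseteq> X - W \<and> card B = k - card W}"
      using fin by (auto simp: H1_def nsets_def card_Diff_subset)
    show "(\<lambda>B. B \<union> W) ` {B. B \<subseteq> X - W \<and> card B = k - card W} \<subseteq> H1 X W k"
    proof clarify
      fix B assume B: "B \<subseteq> X - W" "card B = k - card W"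
      then have "finite B" using assms(1) by (meson Diff_subset finite_subset)
      moreover have "B \<inter> W = {}" using B by blast
      ultimately show "B \<union> W \<in> H1 X W k"
        using B assms fin by (auto simp: H1_def nsets_def card_Un_disjoint)
    qed
  qed (auto simp: H1_def nsets_def)
  then have "card (H1 X W k) = card {B. B \<subseteq> X - W \<and> card B = k - card W}"
    by (rule bij_betw_same_card)
  also have "\<dots> = card (X - W) choose (k - card W)"
    using assms by (intro n_subsets) auto
  finally show ?thesis using assms fin by (simp add: card_Diff_subset)
qed

lemma finite_H1: "finite X \<Longrightarrow> finite (H1 X W k)"
  by (simp add: H1_def finite_imp_finite_nsets)

lemma H2_eq_H1:
  assumes "W \<subseteq> X" shows "H2 n X W k = H1 ({1..n} - (X - W)) W k"
  using assms by (auto simp: H2_def H1_def nsets_def)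

section \<open>Superfamilies, their growth, and almost covers\<close>

abbreviation superfamily :: "'a set set \<Rightarrow> 'a set \<Rightarrow> 'a set set" where
  "superfamily \<F> T \<equiv> {F \<in> \<F>. T \<subseteq> F}"

lemma card_superfamily_le:
  assumes "finite V" "\<F> \<subseteq> nsets V k" "card T \<le> k"
  shows "card (superfamily \<F> T) \<le> (card V - card T) choose (k - card T)"
proof (cases "T \<subseteq> V")
  case True
  have "superfamily \<F> T \<subseteq> H1 V T k" using assms by (auto simp: H1_def)
  then show ?thesis
    using card_mono[OF finite_H1] card_H1[of V T k] assms True by metis
next
  case False
  then have *: "superfamily \<F> T = {}" using assms by (auto simp: nsets_def)
  show ?thesis unfolding * by simp
qed

lemma t_disjoint_commute: "t_disjoint t F G = t_disjoint t G F"
  by (simp add: t_disjoint_def t_intersecting_def Int_commute)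

text \<open>Splitting the symmetric condition lets each counting lemma be applied twice, with the
  roles of the two families exchanged.\<close>

definition almost_half :: "nat \<Rightarrow> nat \<Rightarrow> 'a set set \<Rightarrow> 'a set set \<Rightarrow> bool" where
  "almost_half s t \<F> \<G> \<longleftrightarrow> (\<forall>F\<in>\<F>. card {G\<in>\<G>. t_disjoint t F G} \<le> s)"

lemma almost_cross_iff_halves:
  "almost_cross_t_intersecting s t \<F> \<G> \<longleftrightarrow> almost_half s t \<F> \<G> \<and> almost_half s t \<G> \<F>"
  by (simp add: almost_cross_t_intersecting_def almost_half_def t_disjoint_commute)

text \<open>
  A member \<open>G\<close> that \<open>t\<close>-intersects a \<open>k\<close>-set \<open>F\<close> meets every \<open>(k - t + 1)\<close>-subset of \<open>F\<close>. If \<open>F\<close> is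
  \<open>t\<close>-disjoint from \<open>S\<close>, such a subset can be chosen outside \<open>S\<close>, so \<open>S\<close> can be enlarged in
  \<open>k - t + 1\<close> ways, at the price of at most \<open>s\<close> exceptions.
\<close>

lemma card_superfamily_growth:
  assumes V: "finite V" "\<F> \<subseteq> nsets V k" "\<G> \<subseteq> nsets V k" and t: "0 < t" "t \<le> k"
    and half: "almost_half s t \<F> \<G>"
    and T: "finite T" "card T + b \<le> k"
    and nocover: "\<And>S. finite S \<Longrightarrow> T \<subseteq> S \<Longrightarrow> card S < card T + b \<Longrightarrow> superfamily \<G> S \<noteq> {} \<Longrightarrow>
                    \<exists>F\<in>\<F>. t_disjoint t F S"
  shows "card (superfamily \<G> T) \<le>
           (k - t + 1) ^ b * ((card V - card T - b) choose (k - card T - b)) + s * (\<Sum>i<b. (k - t + 1) ^ i)"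
  using T nocover
proof (induction b arbitrary: T)
  case 0
  then show ?case using card_superfamily_le[of V \<G> k T] V by simp
next
  case (Suc b)
  let ?r = "k - t + 1"
  define M where "M = ?r ^ b * ((card V - card T - Suc b) choose (k - card T - Suc b)) + s * (\<Sum>i<b. ?r ^ i)"
  have fG: "finite \<G>" using V finite_imp_finite_nsets finite_subset by metis
  show ?case
  proof (cases "superfamily \<G> T = {}")
    case True
    show ?thesis unfolding True by simp
  next
    case False
    then obtain F where F: "F \<in> \<F>" "t_disjoint t F T"
      using Suc.prems(3)[of T] Suc.prems(1,2) by auto
    have finF: "finite F" "card F = k" using F V by (auto simp: nsets_def)
    have "card (F \<inter> T) < t" using F by (simp add: t_disjoint_def t_intersecting_def)
    then have "?r \<le> card (F - T)"
      using finF t by (simp add: card_Diff_subset_Int)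
    then obtain D where D: "D \<subseteq> F - T" "card D = ?r" "finite D"
      by (meson obtain_subset_with_card_n)
    have hit: "G \<inter> D \<noteq> {}" if "\<not> t_disjoint t F G" for G
    proof
      assume "G \<inter> D = {}"
      then have "F \<inter> G \<subseteq> F - D" by auto
      then have "card (F \<inter> G) \<le> card (F - D)" using finF by (intro card_mono) auto
      also have "\<dots> = k - ?r" using D finF by (subst card_Diff_subset) auto
      finally show False using that t by (simp add: t_disjoint_def t_intersecting_def)
    qed
    have step: "card (superfamily \<G> (insert x T)) \<le> M" if "x \<in> D" for x
    proof -
      have cx: "card (insert x T) = Suc (card T)" using that D Suc.prems(1) by auto
      have "card (superfamily \<G> (insert x T)) \<le>
              ?r ^ b * ((card V - card (insert x T) - b) choose (k - card (insert x T) - b)) + s * (\<Sum>i<b. ?r ^ i)"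
        by (rule Suc.IH) (use Suc.prems cx in auto)
      then show ?thesis unfolding M_def cx by simp
    qed
    have "superfamily \<G> T \<subseteq> {G\<in>\<G>. t_disjoint t F G} \<union> (\<Union>x\<in>D. superfamily \<G> (insert x T))"
      using hit by fastforce
    then have "card (superfamily \<G> T) \<le> card ({G\<in>\<G>. t_disjoint t F G} \<union> (\<Union>x\<in>D. superfamily \<G> (insert x T)))"
      using fG D by (intro card_mono) auto
    also have "\<dots> \<le> card {G\<in>\<G>. t_disjoint t F G} + card (\<Union>x\<in>D. superfamily \<G> (insert x T))"
      by (rule card_Un_le)
    also have "\<dots> \<le> s + (\<Sum>x\<in>D. card (superfamily \<G> (insert x T)))"
      using half F D(3) by (intro add_mono card_UN_le) (auto simp: almost_half_def)
    also have "\<dots> \<le> s + card D * M"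
      using sum_bounded_above[of D "\<lambda>x. card (superfamily \<G> (insert x T))" M] step by simp
    also have "\<dots> = ?r ^ Suc b * ((card V - card T - Suc b) choose (k - card T - Suc b)) + s * (\<Sum>i<Suc b. ?r ^ i)"
      unfolding D M_def sum.lessThan_Suc_shift by (simp add: algebra_simps sum_distrib_left)
    finally show ?thesis .
  qed
qed

text \<open>In an almost cross-\<open>t\<close>-intersecting pair, the members of one family are such covers of the other.\<close>

definition almost_cover :: "nat \<Rightarrow> nat \<Rightarrow> 'a set set \<Rightarrow> 'a set \<Rightarrow> bool" where
  "almost_cover s t \<F> L \<longleftrightarrow> card {F\<in>\<F>. t_disjoint t F L} \<le> s"

text \<open>Apart from at most \<open>s\<close> exceptions, every member shares \<open>t\<close>
  elements with \<open>L\<close> and so contains a \<open>t\<close>-subset of \<open>L\<close>; sum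
  over these subsets.\<close>

lemma card_le_of_almost_cover:
  assumes "finite \<F>" "finite L" "almost_cover s t \<F> L"
    and "\<And>T. T \<in> nsets L t \<Longrightarrow> card (superfamily \<F> T) \<le> M"
  shows "card \<F> \<le> s + (card L choose t) * M"
proof -
  have finL: "finite (nsets L t)" using assms(2) by (rule finite_imp_finite_nsets)
  have "F \<in> {F\<in>\<F>. t_disjoint t F L} \<union> (\<Union>T\<in>nsets L t. superfamily \<F> T)" if F: "F \<in> \<F>" for F
  proof (cases "t_disjoint t F L")
    case False
    then have "t \<le> card (F \<inter> L)" by (simp add: t_disjoint_def t_intersecting_def)
    then obtain T where "T \<subseteq> F \<inter> L" "card T = t" "finite T" by (meson obtain_subset_with_card_n)
    then show ?thesis using F by (auto simp: nsets_def)
  qed (use F in auto)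
  then have "\<F> \<subseteq> {F\<in>\<F>. t_disjoint t F L} \<union> (\<Union>T\<in>nsets L t. superfamily \<F> T)" by blast
  then have "card \<F> \<le> card ({F\<in>\<F>. t_disjoint t F L} \<union> (\<Union>T\<in>nsets L t. superfamily \<F> T))"
    using assms(1) finL by (intro card_mono) auto
  also have "\<dots> \<le> card {F\<in>\<F>. t_disjoint t F L} + card (\<Union>T\<in>nsets L t. superfamily \<F> T)"
    by (rule card_Un_le)
  also have "\<dots> \<le> s + (\<Sum>T\<in>nsets L t. card (superfamily \<F> T))"
    using assms(3) finL by (intro add_mono card_UN_le) (auto simp: almost_cover_def)
  also have "\<dots> \<le> s + card (nsets L t) * M"
    using sum_bounded_above[of "nsets L t" "\<lambda>T. card (superfamily \<F> T)" M] assms(4) by simp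
  also have "card (nsets L t) = card L choose t"
    using card_H1[of L "{}" t] assms(2) by (simp add: H1_def)
  finally show ?thesis by simp
qed

lemma t_disjoint_if_misses:
  assumes "finite G" "card G = k" "Y \<subseteq> G" "card Y = k - t + 1" "F \<inter> Y = {}" "0 < t" "t \<le> k"
  shows "t_disjoint t F G"
proof -
  have "finite Y" using assms finite_subset by blast
  have "F \<inter> G \<subseteq> G - Y" using assms by auto
  then have "card (F \<inter> G) \<le> card (G - Y)" using assms by (intro card_mono) auto
  also have "\<dots> = k - (k - t + 1)" using assms \<open>finite Y\<close> by (simp add: card_Diff_subset)
  finally show ?thesis using assms by (simp add: t_disjoint_def t_intersecting_def)
qed

lemma t_disjoint_if_not_subset:
  assumes "finite T" "card T = t" "\<not> T \<subseteq> F"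
  shows "t_disjoint t F T"
proof -
  have "F \<inter> T \<subset> T" using assms by auto
  then have "card (F \<inter> T) < card T" using assms psubset_card_mono by blast
  then show ?thesis using assms by (simp add: t_disjoint_def t_intersecting_def)
qed

lemma not_t_disjoint_if_subset:
  assumes "finite F" "card W = t" "W \<subseteq> F" "W \<subseteq> G"
  shows "\<not> t_disjoint t F G"
proof -
  have "card W \<le> card (F \<inter> G)" using assms by (intro card_mono) auto
  then show ?thesis using assms by (simp add: t_disjoint_def t_intersecting_def)
qed

lemma almost_cover_mono:
  assumes "finite \<F>" "almost_cover s t \<F> L" "L \<subseteq> L'" "finite L'"
  shows "almost_cover s t \<F> L'"
proof -
  have "t_disjoint t F L" if "t_disjoint t F L'" for F
  proof -
    have "card (F \<inter> L) \<le> card (F \<inter> L')" using assms by (intro card_mono) auto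
    then show ?thesis using that by (simp add: t_disjoint_def t_intersecting_def)
  qed
  then have "card {F\<in>\<F>. t_disjoint t F L'} \<le> card {F\<in>\<F>. t_disjoint t F L}"
    using assms by (intro card_mono) auto
  then show ?thesis using assms(2) by (simp add: almost_cover_def)
qed

subsection \<open>Estimates for large ground sets\<close>

text \<open>Read x = N, c = c0, d = d0, q = Q, and f, g, b as the sizes of \<F>, \<G> and the
  members of \<G> not containing the kernel. The loss e = d - 2s in f must be paid for by the gain b
  in g, so e x \<le> f b \<le> (m + 1) q b. But e is at least 3q/4 and (m + 1) b at most 3(x + s)/8,
  which forces x \<le> s.\<close>

lemma two_traces_contradiction:
  fixes f g b c d m q s x :: nat
  assumes f: "f + c + d \<le> x + 2 * s"
    and x: "c + (m + 1) * d \<le> x" "x \<le> c + (m + 1) * q"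
    and d: "7 * q \<le> 8 * d" and s: "25 * s \<le> q" "25 * s \<le> x" "0 < s"
    and g: "(x - c) * x \<le> f * g" "g \<le> x + b" and b: "8 * ((m + 1) * b) \<le> 3 * (x + s)"
  shows False
proof -
  define e where "e = d - 2 * s"
  have e: "d = e + 2 * s" "6 * q \<le> 8 * e" using d s(1) by (auto simp: e_def)
  obtain y where y: "x = c + y" using x(1) le_Suc_ex[of c x] by auto
  have fy: "f + e \<le> y" "f \<le> (m + 1) * q" using f x(2) unfolding y e(1) by linarith+
  have "y * x \<le> f * g" using g(1) y by simp
  then have "y * x \<le> f * (x + b)" using g(2) by (meson mult_le_mono2 order_trans)
  then have "y * x + e * x \<le> f * (x + b) + e * x" by simp
  also have "\<dots> = (f + e) * x + f * b" by (simp only: distrib_left distrib_right ac_simps)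
  also have "\<dots> \<le> y * x + (m + 1) * q * b" using fy by (intro add_mono mult_le_mono1)
  finally have "e * x \<le> (m + 1) * q * b" by simp
  then have "8 * (e * x) \<le> 8 * ((m + 1) * q * b)" by (rule mult_le_mono2)
  also have "\<dots> = q * (8 * ((m + 1) * b))" by (simp only: mult_ac)
  also have "\<dots> \<le> q * (3 * (x + s))" using b by (rule mult_le_mono2)
  finally have 1: "8 * (e * x) \<le> q * (3 * (x + s))" .
  have "q * (6 * x) = 6 * q * x" by simp
  also have "\<dots> \<le> 8 * e * x" using e(2) by (rule mult_le_mono1)
  also have "\<dots> = 8 * (e * x)" by (simp only: mult.assoc)
  finally have "q * (6 * x) \<le> q * (3 * (x + s))" using 1 by (rule order_trans)
  moreover have "0 < q" using s by linarith
  ultimately have "6 * x \<le> 3 * (x + s)" by (simp only: mult_le_cancel1)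
  then have "6 * x \<le> 3 * x + 3 * s" by (simp only: distrib_left)
  then show False using s by linarith
qed

section \<open>Consequences of the lower bound on \<open>n\<close>\<close>

locale large_ground_set =
  fixes n k t s m :: nat
  assumes t_pos: "0 < t" and s_pos: "0 < s" and m_ge: "2 \<le> m" and k_eq: "k = t + m"
    and n_ge: "(t + 1)^2 * (2 * (m + 1)^2 + 7 * s) \<le> n"
begin

lemma t_sq: "4 \<le> (t + 1)^2" "2 * t + 2 \<le> (t + 1)^2" "4 * t \<le> (t + 1)^2"
proof -
  obtain u where "t = Suc u" using t_pos by (cases t) auto
  then show "4 \<le> (t + 1)^2" "2 * t + 2 \<le> (t + 1)^2" "4 * t \<le> (t + 1)^2"
    by (simp_all add: power2_eq_square)
qed

text \<open>The form needed in \<open>U_step\<close>: the summand \<open>k + 2\<close> absorbs the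
  subtraction in \<open>n - t - j\<close> for j < m.\<close>

lemma n_ge_step: "2 * (t + 1)^2 * ((m + 1) * m + 2 * s) + k + 2 \<le> n"
proof -
  have "2 * (t + 1)^2 * ((m + 1) * m + 2 * s) + (t + 1)^2 * (2 * (m + 1) + 3 * s) =
          (t + 1)^2 * (2 * (m + 1)^2 + 7 * s)"
    by (simp add: algebra_simps power2_eq_square)
  moreover have "(2 * t + 2) * (m + 1) \<le> (t + 1)^2 * (2 * (m + 1) + 3 * s)"
    using t_sq(2) by (intro mult_le_mono) auto
  moreover have "k + 2 \<le> (2 * t + 2) * (m + 1)" by (simp add: k_eq algebra_simps)
  ultimately show ?thesis using n_ge by linarith
qed

lemma n_ge_sum: "8 * (m + 1)^2 + 7 * s + t + 1 \<le> n" "28 * s + t + 1 \<le> n"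
proof -
  define p q where "p = (t + 1)^2 * (2 * (m + 1)^2)" and "q = (t + 1)^2 * (7 * s)"
  have n: "p + q \<le> n" using n_ge by (simp add: p_def q_def distrib_left)
  have "8 * (m + 1)^2 \<le> p"
    using mult_le_mono1[OF t_sq(1), of "2 * (m + 1)^2"] by (simp add: p_def)
  moreover have "28 * s \<le> q"
    using mult_le_mono1[OF t_sq(1), of "7 * s"] by (simp add: q_def)
  moreover have "t + 1 \<le> p"
    using mult_le_mono[OF t_sq(2), of 1 "2 * (m + 1)^2"] by (simp add: p_def)
  moreover have "7 * s + t + 1 \<le> q"
  proof -
    define X where "X = (t + 1) * (7 * s)"
    have "t + 1 \<le> X"
      using mult_le_mono2[of 1 "7 * s" "t + 1"] s_pos unfolding X_def mult_1_right by simp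
    moreover have "7 * s \<le> X"
      using mult_le_mono1[of 1 "t + 1" "7 * s"] unfolding X_def mult_1_left by simp
    moreover have "2 * X \<le> q"
      using mult_le_mono1[OF t_sq(2), of "7 * s"] by (simp add: X_def q_def algebra_simps)
    ultimately show ?thesis by linarith
  qed
  ultimately show "8 * (m + 1)^2 + 7 * s + t + 1 \<le> n" "28 * s + t + 1 \<le> n"
    using n by linarith+
qed

lemma n_gt_k: "k + 2 \<le> n"
  using n_ge_step by linarith

text \<open>For a \<open>t\<close>-set \<open>W\<close> and an (m + 1)-set \<open>Y\<close> disjoint
  from it, \<open>N\<close> counts the \<open>k\<close>-sets containing \<open>W\<close>, and
  \<open>c0\<close> those that also miss \<open>Y\<close>. \<open>Q\<close> and \<open>d0\<close>
  are the same counts for a (t + 1)-set in place of \<open>W\<close>.\<close>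

abbreviation N where "N \<equiv> (n - t) choose m"
abbreviation Q where "Q \<equiv> (n - t - 1) choose (m - 1)"
abbreviation c0 where "c0 \<equiv> (n - k - 1) choose m"
abbreviation d0 where "d0 \<equiv> (n - k - 2) choose (m - 1)"

lemma Q_ge: "25 * s \<le> Q"
proof -
  have "n - t - 1 \<le> Q"
    using m_ge n_gt_k k_eq by (intro binomial_ge_upper) auto
  then show ?thesis using n_ge_sum(2) by linarith
qed

lemma N_ge: "25 * s \<le> N"
proof -
  have "n - t \<le> N"
    using m_ge n_gt_k k_eq by (intro binomial_ge_upper) auto
  then show ?thesis using n_ge_sum(2) by linarith
qed

lemma c0_ge: "s \<le> c0"
proof -
  have "2 * (m + 1) + 2 * s \<le> (m + 1) * m + 2 * s"
    using mult_le_mono2[OF m_ge, of "m + 1"] by simp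
  also have "\<dots> = 1 * ((m + 1) * m + 2 * s)" by simp
  also have "\<dots> \<le> 2 * (t + 1)^2 * ((m + 1) * m + 2 * s)"
    using t_sq(1) by (intro mult_le_mono1) linarith
  finally have "2 * (m + 1) + 2 * s + k + 2 \<le> n"
    using n_ge_step by (meson add_le_mono1 order_trans)
  moreover from this have "n - k - 1 \<le> c0" using m_ge by (intro binomial_ge_upper) auto
  ultimately show ?thesis by linarith
qed

text \<open>Q exceeds \<open>d0\<close> by at most (m + 1) C, with \<open>?C\<close> written C.
  Absorption, (m - 1) Q = (n - t - 1) C, and n - t - 1 \<ge> 8 (m + 1)^2 make this excess at most
  Q/8.\<close>

lemma d0_ge: "7 * Q \<le> 8 * d0"
proof -
  let ?C = "(n - t - 2) choose (m - 2)"
  have "n - k - 2 + (m + 1) = n - t - 1" using n_gt_k k_eq by simp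
  moreover have "n - k - 2 + (m + 1) - 1 = n - t - 2" using n_gt_k k_eq by simp
  ultimately have 1: "Q \<le> d0 + (m + 1) * ?C"
    using binomial_add_upper[of "m - 1" "n - k - 2" "m + 1"] m_ge by (simp add: numeral_2_eq_2)
  have 2: "(m - 1) * Q = (n - t - 1) * ?C"
    using times_binomial_minus1_eq[of "m - 1" "n - t - 1"] m_ge by (simp add: numeral_2_eq_2)
  have "(n - t - 1) * (8 * (m + 1) * ?C) = 8 * (m + 1) * (m - 1) * Q" using 2 by (simp add: mult_ac)
  also have "\<dots> \<le> (n - t - 1) * Q"
  proof (intro mult_le_mono1)
    have "8 * (m + 1) * (m - 1) \<le> 8 * (m + 1) * (m + 1)" by (intro mult_le_mono) auto
    also have "\<dots> = 8 * (m + 1)^2" by (simp only: power2_eq_square mult.assoc)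
    also have "\<dots> \<le> n - t - 1" using n_ge_sum(1) by linarith
    finally show "8 * (m + 1) * (m - 1) \<le> n - t - 1" .
  qed
  finally have "8 * (m + 1) * ?C \<le> Q"
    using n_ge_sum(1) s_pos by (subst (asm) mult_le_cancel1) simp
  then show ?thesis using 1 by (simp only: mult.assoc)
qed

lemma N_upper: "N \<le> c0 + (m + 1) * Q"
proof -
  have "n - k - 1 + (m + 1) = n - t" "n - k - 1 + (m + 1) - 1 = n - t - 1" using n_gt_k k_eq by simp_all
  then show ?thesis using binomial_add_upper[of m "n - k - 1" "m + 1"] m_ge by simp
qed

lemma N_lower: "c0 + (m + 1) * d0 \<le> N"
proof -
  have "n - k - 1 + (m + 1) = n - t" using n_gt_k k_eq by simp
  then have "c0 + (m + 1) * ((n - k - 1) choose (m - 1)) \<le> N"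
    using binomial_add_lower[of m "n - k - 1" "m + 1"] m_ge by simp
  moreover have "(m + 1) * d0 \<le> (m + 1) * ((n - k - 1) choose (m - 1))"
    by (intro mult_le_mono binomial_right_mono) auto
  ultimately show ?thesis by linarith
qed

text \<open>Bounds \<open>s\<close> plus the number of members through a \<open>t\<close>-set when
  the other family has no almost cover of size in [t, t + b). The second summand replaces
  \<open>s\<close> times one plus a geometric sum; for b = 0 that sum is empty and only
  \<open>s\<close> remains.\<close>

definition U :: "nat \<Rightarrow> nat" where
  "U b = (m + 1) ^ b * ((n - t - b) choose (m - b)) + (if b = 0 then s else 2 * s * (m + 1) ^ (b - 1))"

lemma U_0: "U 0 = N + s"
  by (simp add: U_def)

lemma U_1: "U 1 = (m + 1) * Q + 2 * s"
  by (simp add: U_def)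

text \<open>By absorption the binomial drops by the factor (n - t - j) / (m - j). Since the smaller
  binomial is at least m - j, the term in \<open>s\<close> can be charged to it as well, and
  \<open>n_ge_step\<close> applies.\<close>

lemma U_step:
  assumes "j < m" shows "2 * (t + 1)^2 * U (Suc j) \<le> U j"
proof -
  let ?C = "(n - t - j) choose (m - j)" and ?C' = "(n - t - Suc j) choose (m - Suc j)"
  have p: "m - j \<le> ?C'"
    using binomial_ge_lower[of "m - j" "n - t - Suc j"] assms n_gt_k k_eq by simp
  have rec: "(m - j) * ?C = (n - t - j) * ?C'"
    using times_binomial_minus1_eq[of "m - j" "n - t - j"] assms by simp
  have "(m - j) * (2 * (t + 1)^2 * ((m + 1) * ?C' + 2 * s)) =
        2 * (t + 1)^2 * ((m + 1) * (m - j) * ?C' + 2 * s * (m - j))"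
    unfolding distrib_left by (simp only: mult_ac)
  also have "\<dots> \<le> 2 * (t + 1)^2 * ((m + 1) * m * ?C' + 2 * s * ?C')"
    using p by (intro mult_le_mono add_mono) auto
  also have "\<dots> = 2 * (t + 1)^2 * ((m + 1) * m + 2 * s) * ?C'"
    by (simp add: algebra_simps)
  also have "\<dots> \<le> (n - t - j) * ?C'"
    using n_ge_step k_eq assms by (intro mult_le_mono1) linarith
  finally have "2 * (t + 1)^2 * ((m + 1) * ?C' + 2 * s) \<le> ?C"
    unfolding rec[symmetric] using assms by (subst (asm) mult_le_cancel1) auto
  then have "(m + 1) ^ j * (2 * (t + 1)^2 * ((m + 1) * ?C' + 2 * s)) \<le> (m + 1) ^ j * ?C"
    by (intro mult_le_mono2)
  moreover have "U (Suc j) = (m + 1) ^ j * ((m + 1) * ?C' + 2 * s)"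
    by (simp add: U_def algebra_simps)
  then have "2 * (t + 1)^2 * U (Suc j) = (m + 1) ^ j * (2 * (t + 1)^2 * ((m + 1) * ?C' + 2 * s))"
    by (simp only: mult_ac)
  moreover have "(m + 1) ^ j * ?C \<le> U j" by (simp add: U_def)
  ultimately show ?thesis by linarith
qed

lemma U_power: "j \<le> m \<Longrightarrow> (2 * (t + 1)^2) ^ j * U j \<le> N + s"
proof (induction j)
  case (Suc j)
  have "(2 * (t + 1)^2) ^ j * (2 * (t + 1)^2 * U (Suc j)) \<le> (2 * (t + 1)^2) ^ j * U j"
    using U_step[of j] Suc by (intro mult_le_mono2) auto
  also have "\<dots> \<le> N + s" using Suc by simp
  finally show ?case by (simp only: power_Suc mult_ac)
qed (simp add: U_0)

lemma U_weighted_antimono: "i + j \<le> m \<Longrightarrow> (t + 1) ^ (i + j) * U (i + j) \<le> (t + 1) ^ i * U i"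
proof (induction j)
  case (Suc j)
  have "(t + 1) * U (Suc (i + j)) \<le> 2 * (t + 1)^2 * U (Suc (i + j))"
    by (intro mult_le_mono1) (simp add: power2_eq_square)
  also have "\<dots> \<le> U (i + j)" using Suc by (intro U_step) auto
  finally have "(t + 1) ^ (i + j) * ((t + 1) * U (Suc (i + j))) \<le> (t + 1) ^ (i + j) * U (i + j)"
    by (rule mult_le_mono2)
  also have "\<dots> \<le> (t + 1) ^ i * U i" using Suc by simp
  finally show ?case by (simp only: power_Suc mult_ac add_Suc_right)
qed simp

lemma U_1_sq: "2 * ((t + 1) * U 1 * ((t + 1) * U 1)) \<le> U 1 * (N + s)"
proof -
  have "2 * (t + 1)^2 * U (Suc 0) \<le> N + s" using U_step[of 0] m_ge unfolding U_0 by simp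
  then have "U 1 * (2 * (t + 1)^2 * U 1) \<le> U 1 * (N + s)" unfolding One_nat_def by (rule mult_le_mono2)
  then show ?thesis by (simp only: power2_eq_square mult_ac)
qed

text \<open>If one index is at least 2, its factor is at most half of \<open>U 1\<close>, while the
  other is at most \<open>U 0\<close>. The remaining case a = b = 1 is
  \<open>U_1_sq\<close>.\<close>

lemma U_product:
  assumes "a \<le> m" "b \<le> m" "2 \<le> a + b"
  shows "2 * (((t + 1) ^ a * U a) * ((t + 1) ^ b * U b)) \<le> U 1 * (N + s)"
proof -
  have *: "2 * (((t + 1) ^ a * U a) * ((t + 1) ^ b * U b)) \<le> U 1 * (N + s)"
    if "2 \<le> a" "a \<le> m" "b \<le> m" for a b
  proof -
    have "(t + 1) ^ a * U a \<le> (t + 1) ^ 2 * U 2"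
      using U_weighted_antimono[of 2 "a - 2"] that by (simp only: le_add_diff_inverse)
    moreover have "2 * ((t + 1) ^ 2 * U 2) \<le> U 1"
      using U_step[of 1] m_ge by (simp only: Suc_1 mult.assoc)
    ultimately have "2 * ((t + 1) ^ a * U a) \<le> U 1" by linarith
    moreover have "(t + 1) ^ b * U b \<le> N + s"
      using U_weighted_antimono[of 0 b] that by (simp add: U_0)
    ultimately have "2 * ((t + 1) ^ a * U a) * ((t + 1) ^ b * U b) \<le> U 1 * (N + s)"
      by (intro mult_le_mono)
    then show ?thesis by (simp only: mult.assoc)
  qed
  consider "2 \<le> a" | "2 \<le> b" | "a = 1" "b = 1" using assms by linarith
  then show ?thesis
  proof cases
    case 1 then show ?thesis using * assms by blast
  next
    case 2 then show ?thesis using *[of b a] assms by (simp only: mult.commute)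
  next
    case 3 then show ?thesis using U_1_sq by simp
  qed
qed

lemma main_term_lower: "7 * ((m + 1) * Q * N) \<le> 8 * ((N - c0) * N)"
proof -
  have "7 * ((m + 1) * Q) \<le> (m + 1) * (8 * d0)"
    using mult_le_mono2[OF d0_ge, of "m + 1"] by (simp only: mult_ac)
  also have "\<dots> = 8 * ((m + 1) * d0)" by (simp only: mult_ac)
  also have "\<dots> \<le> 8 * (N - c0)" using N_lower by linarith
  finally show ?thesis using mult_le_mono1 by (simp only: mult.assoc[symmetric])
qed

text \<open>
  By comparison with the extremal pair, \<open>f = |\<F>|\<close> and \<open>g = |\<G>|\<close> satisfy the first inequality for a
  maximal pair.
\<close>

lemma small_product_contradiction:
  assumes "(N - c0) * N \<le> f * g" "2 * (f * g) \<le> U 1 * (N + s)"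
  shows False
proof -
  define M where "M = (m + 1) * Q"
  have "3 * Q \<le> M" unfolding M_def using m_ge by (intro mult_le_mono1) simp
  then have M: "75 * s \<le> M" using Q_ge by linarith
  have lo: "7 * (M * N) \<le> 8 * (f * g)" using assms(1) main_term_lower unfolding M_def by linarith
  have "U 1 = M + 2 * s" by (simp only: U_1 M_def)
  \<comment> \<open>\<open>U 1\<close> is within 77/75 of \<open>M\<close> and N + s within 26/25 of
    \<open>N\<close>. The product 2002/1875 of these ratios is below 7/4, the factor that
    \<open>main_term_lower\<close> demands.\<close>
  then have U: "75 * U 1 \<le> 77 * M" using M by linarith
  define Y where "Y = N + s"
  have Y: "25 * Y \<le> 26 * N" using N_ge unfolding Y_def distrib_left by simp
  have "(75 * U 1) * (25 * Y) \<le> (77 * M) * (26 * N)" using U Y by (rule mult_le_mono)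
  then have "1875 * (U 1 * Y) \<le> 2002 * (M * N)" by (simp add: mult.assoc)
  then have "M * N = 0" using lo assms(2) unfolding Y_def[symmetric] by linarith
  moreover have "0 < M" "0 < N" using M N_ge s_pos by linarith+
  then have "0 < M * N" by (rule mult_pos_pos)
  ultimately show False by linarith
qed

text \<open>\<open>L\<close> has at most (t + 1)^a subsets of size \<open>t\<close>. Starting from
  each of them, the growth lemma can run for \<open>b\<close> steps because no smaller set is an
  almost cover of \<G>.\<close>

lemma card_le_of_almost_cover_size:
  assumes "\<F> \<subseteq> nsets {1..n} k" "\<G> \<subseteq> nsets {1..n} k" "almost_half s t \<G> \<F>"
    and L: "finite L" "card L = t + a" "almost_cover s t \<F> L" and b: "b \<le> m"
    and nocover: "\<And>S. finite S \<Longrightarrow> t \<le> card S \<Longrightarrow> card S < t + b \<Longrightarrow> \<not> almost_cover s t \<G> S"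
  shows "card \<F> \<le> (t + 1) ^ a * U b"
proof -
  define V where "V = (m + 1) ^ b * ((n - t - b) choose (m - b)) + s * (\<Sum>i<b. (m + 1) ^ i)"
  have fin: "finite \<F>" "finite \<G>"
    using assms finite_imp_finite_nsets finite_subset by (metis finite_atLeastAtMost)+
  have "card (superfamily \<F> T) \<le> V" if T: "T \<in> nsets L t" for T
  proof -
    have T': "card T = t" "finite T" using T by (auto simp: nsets_def)
    have "card (superfamily \<F> T) \<le>
           (k - t + 1) ^ b * ((card {1..n} - card T - b) choose (k - card T - b)) + s * (\<Sum>i<b. (k - t + 1) ^ i)"
    proof (rule card_superfamily_growth[of "{1..n}" \<G>])
      fix S assume "finite S" "T \<subseteq> S" "card S < card T + b"
      moreover then have "t \<le> card S" using T' card_mono by blast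
      ultimately have "\<not> almost_cover s t \<G> S" using nocover T' by auto
      then have "{G \<in> \<G>. t_disjoint t G S} \<noteq> {}" unfolding almost_cover_def by (metis card.empty le0)
      then show "\<exists>G\<in>\<G>. t_disjoint t G S" by blast
    qed (use assms T' b t_pos k_eq in auto)
    then show ?thesis using T' k_eq by (simp add: V_def)
  qed
  then have "card \<F> \<le> s + (card L choose t) * V"
    using fin L by (intro card_le_of_almost_cover) auto
  also have "\<dots> \<le> (t + 1) ^ a * s + (t + 1) ^ a * V"
    using binomial_add_le_power[of t a] L by (intro add_mono mult_le_mono1) auto
  also have "\<dots> = (t + 1) ^ a * (s + V)" by (simp add: algebra_simps)
  also have "\<dots> \<le> (t + 1) ^ a * U b"
  proof (rule mult_le_mono2)
    show "s + V \<le> U b"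
    proof (cases "b = 0")
      case False
      then have "s * (1 + (\<Sum>i<b. (m + 1) ^ i)) \<le> s * (2 * (m + 1) ^ (b - 1))"
        using m_ge by (intro mult_le_mono2 sum_power_le) auto
      then show ?thesis using False by (simp add: V_def U_def algebra_simps)
    qed (simp add: V_def U_def)
  qed
  finally show ?thesis .
qed

end

subsection \<open>The extremal pair and set-counting bounds\<close>

context large_ground_set
begin

lemma finite_family: "\<F> \<subseteq> nsets {1..n} k \<Longrightarrow> finite \<F>"
  using finite_imp_finite_nsets finite_subset by (metis finite_atLeastAtMost)

lemma card_H1_full:
  assumes "W \<subseteq> {1..n}" "card W = t" shows "card (H1 {1..n} W k) = N"
  using card_H1[of "{1..n}" W k] assms k_eq by simp

lemma card_H2_full:
  assumes "W \<subseteq> X" "X \<subseteq> {1..n}" "card X = k + 1" "card W = t"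
  shows "card (H2 n X W k) = c0"
proof -
  have fin: "finite X" "finite W" using assms finite_subset by (blast intro: finite_subset)+
  have "card (X - W) = m + 1" using assms fin k_eq by (simp add: card_Diff_subset)
  then have "card ({1..n} - (X - W)) = n - (m + 1)"
    using assms fin by (subst card_Diff_subset) auto
  then have "card (H1 ({1..n} - (X - W)) W k) = (n - (m + 1) - t) choose (k - t)"
    using assms k_eq by (subst card_H1) auto
  moreover have "n - (m + 1) - t = n - k - 1" "k - t = m" using k_eq by auto
  ultimately show ?thesis by (simp add: H2_eq_H1[OF assms(1)])
qed

lemma H2_subset_H1: "H2 n X W k \<subseteq> H1 {1..n} W k"
  by (auto simp: H2_def H1_def)

text \<open>Sets in \<open>K\<close> meet \<open>X\<close> exactly in \<open>W\<close>, hence share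
  only t - 1 elements with any X - {w}. A set in H - K has a further point of \<open>X\<close>,
  which makes up for the lost \<open>w\<close>. So conflicts occur only between the \<open>s\<close>
  retained sets \<open>A\<close> and the \<open>min t s\<close> added sets \<open>B\<close>.\<close>

lemma extremal_pair_exists:
  "\<exists>\<F> \<G>. admissible_pair n k t s \<F> \<G> \<and> card \<F> = N - c0 + s \<and> card \<G> = N + min t s"
proof -
  define X W where "X = {1..k + 1}" and "W = {1..t}"
  have XW: "W \<subseteq> X" "X \<subseteq> {1..n}" "W \<subseteq> {1..n}" "finite X" "finite W" "card X = k + 1" "card W = t"
    using k_eq n_gt_k by (auto simp: X_def W_def)
  define H where "H = H1 {1..n} W k"
  define K where "K = H2 n X W k"
  have KH: "K \<subseteq> H" unfolding H_def K_def by (rule H2_subset_H1)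
  have finH: "finite H" "finite K" using KH finite_H1 finite_subset unfolding H_def by (metis finite_atLeastAtMost)+
  have cards: "card H = N" "card K = c0"
    using card_H1_full card_H2_full XW by (simp_all add: H_def K_def)
  obtain A where A: "A \<subseteq> K" "card A = s" using c0_ge cards obtain_subset_with_card_n by metis
  obtain I where I: "I \<subseteq> W" "card I = min t s" 
  proof -
    have "min t s \<le> card W" using XW by simp
    then show ?thesis using that by (rule obtain_subset_with_card_n)
  qed
  define B where "B = (\<lambda>w. X - {w}) ` I"
  have injB: "inj_on (\<lambda>w. X - {w}) I" using I XW by (auto simp: inj_on_def)
  have finI: "finite I" using I XW finite_subset by blast
  have B: "card B = min t s" "finite B" using injB I finI by (auto simp: B_def card_image)
  have BH: "B \<inter> H = {}" using I by (auto simp: B_def H_def H1_def)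
  have Bsub: "B \<subseteq> nsets {1..n} k"
    using XW I by (auto simp: B_def nsets_def)
  have Hsub: "H \<subseteq> nsets {1..n} k" by (auto simp: H_def H1_def)
  define F' G' where "F' = (H - K) \<union> A" and "G' = H \<union> B"
  have FH: "F' \<subseteq> H" using A KH by (auto simp: F'_def)
  have HH: "\<not> t_disjoint t F G" if "F \<in> H" "G \<in> H" for F G
    using that not_t_disjoint_if_subset[of F W t G] XW by (auto simp: H_def H1_def nsets_def)
  have HB: "\<not> t_disjoint t F G" if "F \<in> H - K" "G \<in> B" for F G
  proof -
    obtain w where w: "w \<in> W" "G = X - {w}" using \<open>G \<in> B\<close> I by (auto simp: B_def)
    have F: "W \<subseteq> F" "finite F" "F \<inter> X \<noteq> W" using that by (auto simp: H_def K_def H1_def H2_def nsets_def)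
    then obtain x where x: "x \<in> F" "x \<in> X" "x \<notin> W" using XW by auto
    have "card (insert x (W - {w})) \<le> card (F \<inter> G)"
      using w F x XW by (intro card_mono) auto
    moreover have "card (insert x (W - {w})) = t"
      using x w XW t_pos by (simp add: card_insert_if)
    ultimately show ?thesis by (simp add: t_disjoint_def t_intersecting_def)
  qed
  have KB: "t_disjoint t F G" if "F \<in> K" "G \<in> B" for F G
  proof -
    obtain w where w: "w \<in> W" "G = X - {w}" using \<open>G \<in> B\<close> I by (auto simp: B_def)
    have "F \<inter> G = W - {w}" using that w by (auto simp: K_def H2_def)
    then show ?thesis using w XW t_pos by (simp add: t_disjoint_def t_intersecting_def)
  qed
  have "almost_half s t F' G'"
    unfolding almost_half_def
  proof
    fix F assume "F \<in> F'"
    then have "{G \<in> G'. t_disjoint t F G} \<subseteq> B" using HH FH by (auto simp: G'_def)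
    then have "card {G \<in> G'. t_disjoint t F G} \<le> card B" using B by (intro card_mono) auto
    then show "card {G \<in> G'. t_disjoint t F G} \<le> s" using B by simp
  qed
  moreover have "almost_half s t G' F'"
    unfolding almost_half_def
  proof
    fix G assume "G \<in> G'"
    then have "{F \<in> F'. t_disjoint t G F} \<subseteq> A"
      using HH HB FH by (auto simp: G'_def F'_def t_disjoint_commute[of t G])
    moreover have "finite A" using A finH finite_subset by blast
    ultimately have "card {F \<in> F'. t_disjoint t G F} \<le> card A" by (intro card_mono) auto
    then show "card {F \<in> F'. t_disjoint t G F} \<le> s" using A by simp
  qed
  moreover have "\<not> cross_t_intersecting t F' G'"
  proof -
    have "A \<noteq> {}" "B \<noteq> {}" using A B s_pos t_pos by auto
    then obtain F G where "F \<in> A" "G \<in> B" by blast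
    then have "F \<in> F'" "G \<in> G'" "t_disjoint t F G" using A KB by (auto simp: F'_def G'_def)
    then show ?thesis by (auto simp: cross_t_intersecting_def t_disjoint_def)
  qed
  moreover have cF: "card F' = N - c0 + s"
    unfolding F'_def using A finH KH cards
    by (subst card_Un_disjoint) (auto simp: card_Diff_subset intro: finite_subset)
  moreover have cG: "card G' = N + min t s"
    unfolding G'_def using B BH finH cards by (subst card_Un_disjoint) auto
  moreover have "card F' \<le> card G'"
  proof -
    have "x - c + s \<le> x + y" if "s \<le> c" "c \<le> x" for x c y :: nat using that by linarith
    then show ?thesis unfolding cF cG using c0_ge card_mono[OF finH(1) KH] unfolding cards by blast
  qed
  moreover have "F' \<subseteq> nsets {1..n} k" "G' \<subseteq> nsets {1..n} k"
    using FH Hsub Bsub by (auto simp: G'_def)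
  ultimately show ?thesis
    unfolding admissible_pair_def almost_cross_iff_halves by blast
qed

text \<open>Choose \<open>y\<close> in Y1 - Y2. The sets missing \<open>Y1\<close> (there are
  \<open>c0\<close>) and the sets through \<open>y\<close> missing \<open>Y2\<close> (there are
  \<open>d0\<close>) are disjoint classes, and each contains at most \<open>s\<close> members of
  \<F>.\<close>

lemma card_hitting_two_le:
  assumes \<F>: "\<F> \<subseteq> H1 {1..n} W k" and W: "W \<subseteq> {1..n}" "card W = t"
    and Y: "Y1 \<subseteq> {1..n} - W" "Y2 \<subseteq> {1..n} - W" "card Y1 = m + 1" "card Y2 = m + 1" "Y1 \<noteq> Y2"
    and few: "card {F\<in>\<F>. F \<inter> Y1 = {}} \<le> s" "card {F\<in>\<F>. F \<inter> Y2 = {}} \<le> s"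
  shows "card \<F> + c0 + d0 \<le> N + 2 * s"
proof -
  have fin: "finite Y1" "finite Y2" "finite W" using Y W by (meson finite_Diff finite_atLeastAtMost finite_subset)+
  have "\<not> Y1 \<subseteq> Y2" using Y fin card_subset_eq[of Y2 Y1] by auto
  then obtain y where y: "y \<in> Y1" "y \<notin> Y2" by blast
  define H A1 A2 where "H = H1 {1..n} W k" and "A1 = H1 ({1..n} - Y1) W k"
    and "A2 = H1 ({1..n} - Y2) (insert y W) k"
  have finH: "finite H" "finite A1" "finite A2" by (simp_all add: H_def A1_def A2_def finite_H1)
  have yW: "y \<notin> W" "y \<in> {1..n}" using y Y by auto
  have "card A1 = (card ({1..n} - Y1) - card W) choose (k - card W)"
    unfolding A1_def using W Y k_eq by (intro card_H1) auto
  also have "card ({1..n} - Y1) = n - (m + 1)" using Y fin by (subst card_Diff_subset) auto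
  finally have c1: "card A1 = c0" using W k_eq by (simp add: add.commute)
  have "card A2 = (card ({1..n} - Y2) - card (insert y W)) choose (k - card (insert y W))"
    unfolding A2_def using W Y k_eq yW y fin m_ge by (intro card_H1) auto
  also have "card ({1..n} - Y2) = n - (m + 1)" using Y fin by (subst card_Diff_subset) auto
  finally have c2: "card A2 = d0" using W k_eq yW fin by (simp add: add.commute)
  have dis: "A1 \<inter> A2 = {}" using y by (auto simp: A1_def A2_def H1_def nsets_def)
  have sub: "A1 \<subseteq> H" "A2 \<subseteq> H" by (auto simp: H_def A1_def A2_def H1_def nsets_def)
  have c3: "card (H - (A1 \<union> A2)) + c0 + d0 = N"
  proof -
    have "card (A1 \<union> A2) = c0 + d0" using finH dis c1 c2 by (simp add: card_Un_disjoint)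
    moreover have "card (H - (A1 \<union> A2)) = card H - card (A1 \<union> A2)" using finH sub by (intro card_Diff_subset) auto
    moreover have "card (A1 \<union> A2) \<le> card H" using finH sub by (intro card_mono) auto
    moreover have "card H = N" using card_H1_full W by (simp add: H_def)
    ultimately show ?thesis by linarith
  qed
  have finF: "finite \<F>" using \<F> finH finite_subset unfolding H_def by blast
  have "\<F> \<subseteq> (H - (A1 \<union> A2)) \<union> ({F\<in>\<F>. F \<inter> Y1 = {}} \<union> {F\<in>\<F>. F \<inter> Y2 = {}})"
    using \<F> by (auto simp: H_def A1_def A2_def H1_def nsets_def)
  then have "card \<F> \<le> card ((H - (A1 \<union> A2)) \<union> ({F\<in>\<F>. F \<inter> Y1 = {}} \<union> {F\<in>\<F>. F \<inter> Y2 = {}}))"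
    using finH finF by (intro card_mono) auto
  also have "\<dots> \<le> card (H - (A1 \<union> A2)) + card ({F\<in>\<F>. F \<inter> Y1 = {}} \<union> {F\<in>\<F>. F \<inter> Y2 = {}})"
    by (rule card_Un_le)
  also have "card ({F\<in>\<F>. F \<inter> Y1 = {}} \<union> {F\<in>\<F>. F \<inter> Y2 = {}}) \<le> s + s"
    using few by (intro order_trans[OF card_Un_le] add_mono)
  finally show ?thesis using c3 by linarith
qed

lemma card_le_of_hitting_set:
  assumes "\<F> \<subseteq> H1 {1..n} W k" "finite W" "card W = t" "finite D"
    and "\<And>F. F \<in> \<F> \<Longrightarrow> F \<inter> (D - W) \<noteq> {}"
  shows "card \<F> \<le> card (D - W) * Q"
proof -
  have sub: "\<F> \<subseteq> nsets {1..n} k" using assms(1) by (auto simp: H1_def)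
  have "\<F> \<subseteq> (\<Union>x\<in>D - W. superfamily \<F> (insert x W))" using assms by (fastforce simp: H1_def)
  then have "card \<F> \<le> card (\<Union>x\<in>D - W. superfamily \<F> (insert x W))"
    using assms finite_family[OF sub] by (intro card_mono) auto
  also have "\<dots> \<le> (\<Sum>x\<in>D - W. card (superfamily \<F> (insert x W)))"
    using assms by (intro card_UN_le) auto
  also have "\<dots> \<le> of_nat (card (D - W)) * Q"
  proof (rule sum_bounded_above)
    fix x assume "x \<in> D - W"
    then have "card (insert x W) = t + 1" using assms by simp
    then show "card (superfamily \<F> (insert x W)) \<le> Q"
      using card_superfamily_le[of "{1..n}" \<F> k "insert x W"] sub k_eq m_ge by simp
  qed
  finally show ?thesis by simp
qed

text \<open>One growth step from \<open>T\<close>, where the only set to check is \<open>T\<close>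
  itself. It costs \<open>s\<close> once while \<open>U 1\<close> contains 2s, so a further
  \<open>s\<close> remains available.\<close>

lemma card_superfamily_add_le_U1:
  assumes "\<F> \<subseteq> nsets {1..n} k" "\<G> \<subseteq> nsets {1..n} k" "almost_half s t \<F> \<G>"
    and T: "finite T" "card T = t" and F: "F \<in> \<F>" "\<not> T \<subseteq> F"
  shows "card (superfamily \<G> T) + s \<le> U 1"
proof -
  have "card (superfamily \<G> T) \<le>
      (k - t + 1) ^ 1 * ((card {1..n} - card T - 1) choose (k - card T - 1)) + s * (\<Sum>i<1. (k - t + 1) ^ i)"
  proof (rule card_superfamily_growth[of "{1..n}" \<F>])
    fix S assume S: "finite S" "T \<subseteq> S" "card S < card T + 1"
    then have "S = T" using card_seteq by (metis Suc_eq_plus1 less_Suc_eq_le)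
    then show "\<exists>F\<in>\<F>. t_disjoint t F S" using F T t_disjoint_if_not_subset by blast
  qed (use assms t_pos k_eq m_ge in auto)
  then show ?thesis using T k_eq by (simp add: U_def)
qed

text \<open>Any member of \<G> is an almost cover of \<F> of size k = t + m, so a least
  \<open>a\<close> exists and is at most \<open>m\<close>.\<close>

lemma min_almost_cover:
  assumes "almost_half s t \<G> \<F>" "\<G> \<subseteq> nsets {1..n} k" "\<G> \<noteq> {}"
  obtains a L where "a \<le> m" "finite L" "card L = t + a" "almost_cover s t \<F> L"
    "\<And>S :: nat set. finite S \<Longrightarrow> t \<le> card S \<Longrightarrow> card S < t + a \<Longrightarrow> \<not> almost_cover s t \<F> S"
proof -
  define P where "P a \<longleftrightarrow> (\<exists>L. finite L \<and> card L = t + a \<and> almost_cover s t \<F> L)" for a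
  obtain G where G: "G \<in> \<G>" using assms by blast
  then have "almost_cover s t \<F> G"
    using assms(1) by (auto simp: almost_cover_def almost_half_def t_disjoint_commute[of t _ G])
  then have "P m" using G assms(2) k_eq by (auto simp: P_def nsets_def)
  define a where "a = (LEAST a. P a)"
  have "P a" using \<open>P m\<close> unfolding a_def by (rule LeastI)
  then obtain L where L: "finite L" "card L = t + a" "almost_cover s t \<F> L" by (auto simp: P_def)
  show ?thesis
  proof (rule that[of a L])
    show "a \<le> m" unfolding a_def using \<open>P m\<close> by (rule Least_le)
    fix S :: "nat set" assume S: "finite S" "t \<le> card S" "card S < t + a"
    show "\<not> almost_cover s t \<F> S"
    proof
      assume "almost_cover s t \<F> S"
      then have "P (card S - t)" using S by (auto simp: P_def)
      then have "a \<le> card S - t" unfolding a_def by (rule Least_le)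
      then show False using S by linarith
    qed
  qed (use L in auto)
qed

end

subsection \<open>Maximal pairs\<close>

text \<open>Maximality enters only as \<open>product_ge\<close>, the comparison with the pair of
  \<open>extremal_pair_exists\<close>.\<close>

locale maximal_pair = large_ground_set +
  fixes \<F> \<G> :: "nat set set"
  assumes F_sub: "\<F> \<subseteq> nsets {1..n} k" and G_sub: "\<G> \<subseteq> nsets {1..n} k"
    and halves: "almost_half s t \<F> \<G>" "almost_half s t \<G> \<F>"
    and not_cross: "\<not> cross_t_intersecting t \<F> \<G>"
    and card_le: "card \<F> \<le> card \<G>"
    and product_ge: "(N - c0 + s) * (N + min t s) \<le> card \<F> * card \<G>"
begin

lemma fin: "finite \<F>" "finite \<G>"
  using F_sub G_sub finite_family by blast+

lemma F_D: "F \<in> \<F> \<Longrightarrow> F \<subseteq> {1..n} \<and> finite F \<and> card F = k"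
  and G_D: "G \<in> \<G> \<Longrightarrow> G \<subseteq> {1..n} \<and> finite G \<and> card G = k"
  using F_sub G_sub by (auto simp: nsets_def)

lemma obtain_t_disjoint:
  obtains F G where "F \<in> \<F>" "G \<in> \<G>" "t_disjoint t F G"
  using not_cross by (auto simp: cross_t_intersecting_def t_disjoint_def)

lemma main_term_le: "(N - c0) * N \<le> card \<F> * card \<G>"
  by (rule order_trans[OF mult_le_mono product_ge]) auto

lemma not_small: "\<not> 2 * (card \<F> * card \<G>) \<le> U 1 * (N + s)"
  using small_product_contradiction main_term_le by blast

lemma not_both_small:
  assumes "card \<F> \<le> U 1" shows "\<not> card \<G> \<le> (t + 1) * U 1"
proof
  assume "card \<G> \<le> (t + 1) * U 1"
  then have "card \<F> * card \<G> \<le> ((t + 1) * U 1) * ((t + 1) * U 1)"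
    using assms by (intro mult_le_mono) auto
  then show False using U_1_sq not_small by linarith
qed

lemma obtain_covers:
  obtains W Z where "finite W" "card W = t" "almost_cover s t \<F> W"
    "finite Z" "card Z = t + 1" "almost_cover s t \<G> Z"
proof -
  have ne: "\<F> \<noteq> {}" "\<G> \<noteq> {}" using obtain_t_disjoint by blast+
  obtain a L where a: "a \<le> m" "finite L" "card L = t + a" "almost_cover s t \<F> L"
    and amin: "\<And>S :: nat set. finite S \<Longrightarrow> t \<le> card S \<Longrightarrow> card S < t + a \<Longrightarrow> \<not> almost_cover s t \<F> S"
    using min_almost_cover[OF halves(2) G_sub ne(2)] by metis
  obtain b M where b: "b \<le> m" "finite M" "card M = t + b" "almost_cover s t \<G> M"
    and bmin: "\<And>S :: nat set. finite S \<Longrightarrow> t \<le> card S \<Longrightarrow> card S < t + b \<Longrightarrow> \<not> almost_cover s t \<G> S"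
    using min_almost_cover[OF halves(1) F_sub ne(1)] by metis
  have cF: "card \<F> \<le> (t + 1) ^ a * U b"
    by (rule card_le_of_almost_cover_size[OF F_sub G_sub halves(2) a(2-4) b(1) bmin])
  have cG: "card \<G> \<le> (t + 1) ^ b * U a"
    by (rule card_le_of_almost_cover_size[OF G_sub F_sub halves(1) b(2-4) a(1) amin])
  have "a + b \<le> 1"
  proof (rule ccontr)
    assume "\<not> a + b \<le> 1"
    then have "2 * (((t + 1) ^ a * U a) * ((t + 1) ^ b * U b)) \<le> U 1 * (N + s)"
      using a b by (intro U_product) auto
    moreover have "card \<F> * card \<G> \<le> ((t + 1) ^ a * U b) * ((t + 1) ^ b * U a)"
      using cF cG by (rule mult_le_mono)
    moreover have "((t + 1) ^ a * U b) * ((t + 1) ^ b * U a) = ((t + 1) ^ a * U a) * ((t + 1) ^ b * U b)"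
      by (simp only: mult_ac)
    ultimately show False using not_small by linarith
  qed
  \<comment> \<open>With a = 1 and b = 0 the larger family \<G>, and therefore \<F> too, would have
    at most \<open>U 1\<close> members.\<close>
  moreover have "a = 0"
  proof (rule ccontr)
    assume "a \<noteq> 0"
    then have "a = 1" "b = 0" using \<open>a + b \<le> 1\<close> by auto
    then have "card \<G> \<le> U 1" using cG by simp
    then show False using not_both_small card_le by simp
  qed
  ultimately have "b \<le> 1" by simp
  obtain z where "z \<notin> M" using b(2) ex_new_if_finite infinite_UNIV_nat by blast
  \<comment> \<open>A cover of size \<open>t\<close> stays a cover after adding an arbitrary point,
    so size t + 1 is attained also when b = 0.\<close>
  have "\<exists>Z. finite Z \<and> card Z = t + 1 \<and> almost_cover s t \<G> Z"
  proof (cases "b = 0")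
    case True
    then show ?thesis using almost_cover_mono[OF fin(2) b(4), of "insert z M"] b \<open>z \<notin> M\<close>
      by (intro exI[of _ "insert z M"]) auto
  next
    case False
    then show ?thesis using b \<open>b \<le> 1\<close> by (intro exI[of _ M]) auto
  qed
  then show ?thesis using that a \<open>a = 0\<close> by auto
qed

text \<open>
  A \<open>t\<close>-subset of \<open>Z\<close> that is not contained in all members of \<open>\<F>\<close> lies in few members of \<open>\<G>\<close>, so
  not all \<open>t\<close>-subsets of \<open>Z\<close> are of this kind; if two were not, all members of \<open>\<F>\<close> would contain \<open>Z\<close>.
\<close>

lemma obtain_kernel:
  obtains W z where "finite W" "card W = t" "z \<notin> W" "\<And>F. F \<in> \<F> \<Longrightarrow> W \<subseteq> F"
    "almost_cover s t \<G> (insert z W)"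
    "\<And>w. w \<in> W \<Longrightarrow> \<exists>F\<in>\<F>. \<not> insert z W - {w} \<subseteq> F"
proof -
  obtain W' Z where W': "finite W'" "card W' = t" "almost_cover s t \<F> W'"
    and Z: "finite Z" "card Z = t + 1" "almost_cover s t \<G> Z"
    by (rule obtain_covers)
  \<comment> \<open>If all of \<G> contains W', some \<open>F\<close> does not, as the pair is not
    cross-\<open>t\<close>-intersecting; one growth step then bounds \<G>. Otherwise some
    \<open>G\<close> omits part of W' and bounds the members of \<F> through W', and at most
    \<open>s\<close> others exist.\<close>
  have FU: "card \<F> \<le> U 1"
  proof (cases "\<forall>G\<in>\<G>. W' \<subseteq> G")
    case True
    then have G: "superfamily \<G> W' = \<G>" by auto
    obtain F where F: "F \<in> \<F>" "\<not> W' \<subseteq> F"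
      using obtain_t_disjoint not_t_disjoint_if_subset F_D W' True by metis
    have "card \<G> \<le> U 1"
      using card_superfamily_add_le_U1[OF F_sub G_sub halves(1) W'(1,2) F] unfolding G by simp
    then show ?thesis using card_le by simp
  next
    case False
    then obtain G where G: "G \<in> \<G>" "\<not> W' \<subseteq> G" by auto
    have 1: "card (superfamily \<F> W') + s \<le> U 1"
      using card_superfamily_add_le_U1[OF G_sub F_sub halves(2) W'(1,2) G] .
    have "card \<F> \<le> s + (card W' choose t) * card (superfamily \<F> W')"
    proof (rule card_le_of_almost_cover[OF fin(1) W'(1,3)])
      fix T assume "T \<in> nsets W' t"
      then have "T = W'" using W' card_subset_eq by (auto simp: nsets_def)
      then show "card (superfamily \<F> T) \<le> card (superfamily \<F> W')" by simp
    qed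
    then show ?thesis using 1 W' by simp
  qed
  have "\<exists>W\<in>nsets Z t. \<forall>F\<in>\<F>. W \<subseteq> F"
  proof (rule ccontr)
    assume none: "\<not> ?thesis"
    have "card \<G> \<le> s + (card Z choose t) * (U 1 - s)"
    proof (rule card_le_of_almost_cover[OF fin(2) Z(1,3)])
      fix T assume T: "T \<in> nsets Z t"
      then obtain F where F: "F \<in> \<F>" "\<not> T \<subseteq> F" using none by blast
      have "finite T" "card T = t" using T by (auto simp: nsets_def)
      then show "card (superfamily \<G> T) \<le> U 1 - s"
        using card_superfamily_add_le_U1[OF F_sub G_sub halves(1) _ _ F] by fastforce
    qed
    also have "\<dots> = s + (t + 1) * (U 1 - s)" using Z by simp
    also have "\<dots> \<le> (t + 1) * s + (t + 1) * (U 1 - s)" by simp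
    also have "\<dots> = (t + 1) * (s + (U 1 - s))" by (simp only: distrib_left)
    also have "s + (U 1 - s) = U 1" unfolding U_1 by simp
    finally show False using not_both_small[OF FU] by simp
  qed
  then obtain W where W: "W \<subseteq> Z" "card W = t" "finite W" and WF: "\<And>F. F \<in> \<F> \<Longrightarrow> W \<subseteq> F"
    by (auto simp: nsets_def)
  \<comment> \<open>If all of \<F> contained \<open>Z\<close>, a growth step from this (t + 1)-set
    would give |\<F>| \<le> U 2, while |\<G>| \<le> (t + 1)(N + s). By \<open>U_step\<close> the
    product is too small.\<close>
  have "\<exists>F\<in>\<F>. \<not> Z \<subseteq> F"
  proof (rule ccontr)
    assume "\<not> ?thesis"
    then have all: "superfamily \<F> Z = \<F>" by auto
    obtain F G where FG: "F \<in> \<F>" "G \<in> \<G>" "t_disjoint t F G" by (rule obtain_t_disjoint)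
    have "card (superfamily \<F> Z) \<le>
        (k - t + 1) ^ 1 * ((card {1..n} - card Z - 1) choose (k - card Z - 1)) + s * (\<Sum>i<1. (k - t + 1) ^ i)"
    proof (rule card_superfamily_growth[of "{1..n}" \<G>])
      fix S assume S: "finite S" "Z \<subseteq> S" "card S < card Z + 1"
      then have "S = Z" using card_seteq by (metis Suc_eq_plus1 less_Suc_eq_le)
      have "card (G \<inter> Z) \<le> card (F \<inter> G)" using all FG F_D by (intro card_mono) auto
      then have "t_disjoint t G S" using FG \<open>S = Z\<close> by (simp add: t_disjoint_def t_intersecting_def)
      then show "\<exists>G\<in>\<G>. t_disjoint t G S" using FG by blast
    qed (use F_sub G_sub halves Z t_pos k_eq m_ge in auto)
    then have "card \<F> \<le> (m + 1) * ((n - t - 2) choose (m - 2)) + s"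
      unfolding all using Z k_eq by (simp add: numeral_2_eq_2)
    also have "\<dots> \<le> U 2"
    proof -
      have "1 * ((m + 1) * ((n - t - 2) choose (m - 2))) \<le> (m + 1) * ((m + 1) * ((n - t - 2) choose (m - 2)))"
        by (intro mult_le_mono1) simp
      then show ?thesis by (simp add: U_def power2_eq_square algebra_simps)
    qed
    finally have cF: "card \<F> \<le> U 2" .
    have "card \<G> \<le> s + (card Z choose t) * N"
    proof (rule card_le_of_almost_cover[OF fin(2) Z(1,3)])
      fix T assume "T \<in> nsets Z t"
      then show "card (superfamily \<G> T) \<le> N"
        using card_superfamily_le[of "{1..n}" \<G> k T] G_sub k_eq by (auto simp: nsets_def)
    qed
    also have "\<dots> \<le> (t + 1) * s + (t + 1) * N" using Z by simp
    also have "\<dots> = (t + 1) * (N + s)" by (simp only: distrib_left add.commute)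
    finally have "card \<F> * card \<G> \<le> U 2 * ((t + 1) * (N + s))" using cF by (intro mult_le_mono)
    then have "2 * (card \<F> * card \<G>) \<le> 2 * (t + 1) * U 2 * (N + s)" by (simp only: mult_ac)
    also have "\<dots> \<le> U 1 * (N + s)"
    proof (rule mult_le_mono1)
      have "2 * (t + 1) * U 2 \<le> 2 * (t + 1)^2 * U 2"
        by (intro mult_le_mono1) (simp add: power2_eq_square)
      also have "\<dots> \<le> U 1" using U_step[of 1] m_ge by (simp only: Suc_1)
      finally show "2 * (t + 1) * U 2 \<le> U 1" .
    qed
    finally show False using not_small by simp
  qed
  then obtain F0 where F0: "F0 \<in> \<F>" "\<not> Z \<subseteq> F0" by blast
  have "card (Z - W) = 1" using W Z by (simp add: card_Diff_subset)
  then obtain z where "Z - W = {z}" by (auto simp: card_1_singleton_iff)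
  then have z: "Z = insert z W" "z \<notin> W" using W by auto
  then have "z \<notin> F0" using F0 WF by auto
  \<comment> \<open>Each Z - {w} with \<open>w\<close> in \<open>W\<close> contains
    \<open>z\<close>, so the single set \<open>F0\<close> is a witness for every
    \<open>w\<close>.\<close>
  then have "\<And>w. w \<in> W \<Longrightarrow> \<exists>F\<in>\<F>. \<not> insert z W - {w} \<subseteq> F" using F0 z by blast
  then show ?thesis using that W z WF Z by blast
qed

end

section \<open>The members of \<G> that do not contain the kernel \<open>W\<close>\<close>

locale maximal_pair_kernel = maximal_pair +
  fixes W z
  assumes W: "finite W" "card W = t" and z: "z \<notin> W" and WF: "\<And>F. F \<in> \<F> \<Longrightarrow> W \<subseteq> F"
    and cover: "almost_cover s t \<G> (insert z W)"
    and bad: "\<And>w. w \<in> W \<Longrightarrow> \<exists>F\<in>\<F>. \<not> insert z W - {w} \<subseteq> F"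
begin

definition B where "B = {G\<in>\<G>. \<not> W \<subseteq> G}"

lemma F_H1: "\<F> \<subseteq> H1 {1..n} W k"
  using F_sub WF by (auto simp: H1_def)

lemma W_sub: "W \<subseteq> {1..n}"
proof -
  obtain F G where "F \<in> \<F>" by (rule obtain_t_disjoint)
  then show ?thesis using WF F_D by blast
qed

lemma card_G_le: "card \<G> \<le> N + card B"
proof -
  have "\<G> = superfamily \<G> W \<union> B" by (auto simp: B_def)
  then have "card \<G> \<le> card (superfamily \<G> W) + card B" by (metis card_Un_le)
  moreover have "card (superfamily \<G> W) \<le> N"
    using card_superfamily_le[of "{1..n}" \<G> k W] G_sub k_eq W by simp
  ultimately show ?thesis by linarith
qed

text \<open>Let G in \<open>B\<close> miss \<open>w\<close> in \<open>W\<close>. If it shares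
  \<open>t\<close> elements with the (t + 1)-set \<open>insert z W\<close>, it must contain all the
  others. At most \<open>s\<close> members share fewer.\<close>

lemma card_B_le:
  assumes "\<And>w. w \<in> W \<Longrightarrow> card {G\<in>\<G>. w \<notin> G \<and> insert z W - {w} \<subseteq> G} \<le> x"
  shows "card B \<le> s + t * x"
proof -
  let ?Z = "insert z W"
  have "G \<in> {G\<in>\<G>. t_disjoint t G ?Z} \<union> (\<Union>w\<in>W. {G\<in>\<G>. w \<notin> G \<and> ?Z - {w} \<subseteq> G})" if G: "G \<in> B" for G
  proof (cases "t_disjoint t G ?Z")
    case False
    obtain w where w: "w \<in> W" "w \<notin> G" "G \<in> \<G>" using G by (auto simp: B_def)
    have "card (?Z - {w}) = t" using w W z t_pos by simp
    moreover have "G \<inter> ?Z \<subseteq> ?Z - {w}" using w by auto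
    moreover have "t \<le> card (G \<inter> ?Z)" using False by (simp add: t_disjoint_def t_intersecting_def)
    ultimately have "G \<inter> ?Z = ?Z - {w}" using W by (intro card_seteq) auto
    then show ?thesis using w by blast
  qed (use G in \<open>auto simp: B_def\<close>)
  then have "card B \<le> card ({G\<in>\<G>. t_disjoint t G ?Z} \<union> (\<Union>w\<in>W. {G\<in>\<G>. w \<notin> G \<and> ?Z - {w} \<subseteq> G}))"
    using fin W by (intro card_mono) auto
  also have "\<dots> \<le> card {G\<in>\<G>. t_disjoint t G ?Z} + card (\<Union>w\<in>W. {G\<in>\<G>. w \<notin> G \<and> ?Z - {w} \<subseteq> G})"
    by (rule card_Un_le)
  also have "\<dots> \<le> s + (\<Sum>w\<in>W. card {G\<in>\<G>. w \<notin> G \<and> ?Z - {w} \<subseteq> G})"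
    using cover W by (intro add_mono card_UN_le) (auto simp: almost_cover_def)
  also have "\<dots> \<le> s + card W * x"
    using sum_bounded_above[of W "\<lambda>w. card {G\<in>\<G>. w \<notin> G \<and> ?Z - {w} \<subseteq> G}" x] assms by simp
  finally show ?thesis using W by simp
qed

lemma card_B_le_U1: "card B \<le> t * U 1"
proof -
  have "card B \<le> s + t * (U 1 - s)"
  proof (rule card_B_le)
    fix w assume w: "w \<in> W"
    obtain F where F: "F \<in> \<F>" "\<not> insert z W - {w} \<subseteq> F" using bad w by blast
    have "card (superfamily \<G> (insert z W - {w})) + s \<le> U 1"
      using w W z t_pos by (intro card_superfamily_add_le_U1[OF F_sub G_sub halves(1) _ _ F]) auto
    moreover have "card {G\<in>\<G>. w \<notin> G \<and> insert z W - {w} \<subseteq> G} \<le> card (superfamily \<G> (insert z W - {w}))"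
      using fin by (intro card_mono) auto
    ultimately show "card {G\<in>\<G>. w \<notin> G \<and> insert z W - {w} \<subseteq> G} \<le> U 1 - s" by linarith
  qed
  also have "\<dots> \<le> t * s + t * (U 1 - s)" using t_pos by simp
  also have "\<dots> = t * (s + (U 1 - s))" by (simp only: distrib_left)
  also have "s + (U 1 - s) = U 1" unfolding U_1 by simp
  finally show ?thesis .
qed

text \<open>
  If a single set of size about \<open>m / 2\<close> meets all members of \<open>\<F>\<close> outside \<open>W\<close>, then \<open>|\<F>|\<close> is at
  most about half of its extremal value, and no gain in \<open>|\<G>|\<close> makes up for that.
\<close>

lemma no_small_hitting_set:
  assumes "finite D" "\<And>F. F \<in> \<F> \<Longrightarrow> F \<inter> (D - W) \<noteq> {}" "2 * card (D - W) \<le> m + 1"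
  shows False
proof -
  define M where "M = (m + 1) * Q * N"
  have cF: "2 * card \<F> \<le> (m + 1) * Q"
  proof -
    have "2 * card \<F> \<le> 2 * (card (D - W) * Q)"
      using card_le_of_hitting_set[OF F_H1 W assms(1,2)] by simp
    also have "\<dots> = 2 * card (D - W) * Q" by simp
    also have "\<dots> \<le> (m + 1) * Q" using assms(3) by (rule mult_le_mono1)
    finally show ?thesis .
  qed
  have "8 * (t * U 1) \<le> N + s"
  proof -
    have "8 * (t * U 1) = 2 * (4 * t) * U 1" by simp
    also have "\<dots> \<le> 2 * (t + 1)^2 * U 1"
      using t_sq(3) by (intro mult_le_mono1 mult_le_mono2)
    also have "\<dots> \<le> N + s" using U_step[of 0] m_ge unfolding U_0 by simp
    finally show ?thesis .
  qed
  then have "8 * card B \<le> N + s" using card_B_le_U1 by linarith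
  \<comment> \<open>From |B| \<le> (N + s)/8 and s \<le> N/25, using 200 + 25 + 1 = 226. With \<F>
    at most half of (m + 1) Q, the product ratio 226/400 is below 7/8.\<close>
  then have cG: "200 * card \<G> \<le> 226 * N"
  proof -
    have "200 * g \<le> 226 * x" if "g \<le> x + b" "8 * b \<le> x + s" "25 * s \<le> x" for x g b :: nat
      using that by linarith
    then show ?thesis using card_G_le N_ge \<open>8 * card B \<le> N + s\<close> by blast
  qed
  have "2 * card \<F> * (200 * card \<G>) \<le> (m + 1) * Q * (226 * N)" using cF cG by (rule mult_le_mono)
  then have "400 * (card \<F> * card \<G>) \<le> 226 * M" unfolding M_def by (simp add: mult_ac)
  moreover have "7 * M \<le> 8 * (card \<F> * card \<G>)"
    using main_term_lower main_term_le unfolding M_def by linarith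
  moreover have "0 < M"
  proof -
    have "0 < Q" "0 < N" using Q_ge N_ge s_pos by linarith+
    then show ?thesis unfolding M_def by (metis add_gr_0 less_numeral_extra(1) mult_pos_pos)
  qed
  ultimately show False by linarith
qed

lemma few_miss:
  assumes "G \<in> \<G>" "Y \<subseteq> G" "card Y = m + 1"
  shows "card {F\<in>\<F>. F \<inter> Y = {}} \<le> s"
proof -
  have "{F\<in>\<F>. F \<inter> Y = {}} \<subseteq> {F\<in>\<F>. t_disjoint t G F}"
    using t_disjoint_if_misses[of G k Y t] assms G_D t_pos k_eq by (auto simp: t_disjoint_commute[of t G])
  then have "card {F\<in>\<F>. F \<inter> Y = {}} \<le> card {F\<in>\<F>. t_disjoint t G F}"
    using fin by (intro card_mono) auto
  also have "\<dots> \<le> s" using halves assms by (auto simp: almost_half_def)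
  finally show ?thesis .
qed

text \<open>Growth now runs for \<open>j\<close> steps inside the members avoiding a fixed
  \<open>w\<close>. A set \<open>S\<close> reached on the way has exactly t - 1 elements in
  \<open>W\<close> and at most \<open>j\<close> outside. If it \<open>t\<close>-intersected all of
  \<F>, then S - W would be a hitting set excluded by \<open>no_small_hitting_set\<close>.\<close>

lemma card_B_le_U:
  assumes "0 < j" "j \<le> m" "2 * j \<le> m + 1"
  shows "card B \<le> t * U j"
proof -
  define V where "V = (m + 1) ^ j * ((n - t - j) choose (m - j)) + s * (\<Sum>i<j. (m + 1) ^ i)"
  have "card B \<le> s + t * V"
  proof (rule card_B_le)
    fix w assume w: "w \<in> W"
    let ?T = "insert z W - {w}" and ?G = "{G\<in>\<G>. w \<notin> G}"
    have T: "finite ?T" "card ?T = t" using w W z t_pos by auto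
    have "card (superfamily ?G ?T) \<le>
        (k - t + 1) ^ j * ((card {1..n} - card ?T - j) choose (k - card ?T - j)) + s * (\<Sum>i<j. (k - t + 1) ^ i)"
    proof (rule card_superfamily_growth[of "{1..n}" \<F>])
      show "almost_half s t \<F> ?G"
        unfolding almost_half_def
      proof
        fix F assume F: "F \<in> \<F>"
        have "card {G \<in> ?G. t_disjoint t F G} \<le> card {G \<in> \<G>. t_disjoint t F G}"
          using fin by (intro card_mono) auto
        then show "card {G \<in> ?G. t_disjoint t F G} \<le> s"
          using halves(1) F unfolding almost_half_def by (meson order_trans)
      qed
    next
      fix S assume S: "finite S" "?T \<subseteq> S" "card S < card ?T + j" "superfamily ?G S \<noteq> {}"
      \<comment> \<open>The nonemptiness premise of \<open>card_superfamily_growth\<close> is what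
        yields this: \<open>S\<close> lies in some member avoiding \<open>w\<close>.\<close>
      then have wS: "w \<notin> S" by auto
      show "\<exists>F\<in>\<F>. t_disjoint t F S"
      proof (rule ccontr)
        assume none: "\<not> ?thesis"
        have WS: "S \<inter> W = W - {w}" using S(2) wS by auto
        have c: "card (S \<inter> W) = t - 1" unfolding WS using W w by simp
        have cS: "card (S - W) = card S - (t - 1)"
          using S(1) c by (simp add: card_Diff_subset_Int)
        show False
        proof (rule no_small_hitting_set[OF S(1)])
          fix F assume F: "F \<in> \<F>"
          show "F \<inter> (S - W) \<noteq> {}"
          proof
            assume "F \<inter> (S - W) = {}"
            then have "F \<inter> S \<subseteq> S \<inter> W" by auto
            then have "card (F \<inter> S) \<le> t - 1" using c S(1) by (metis card_mono finite_Int)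
            then show False using none F t_pos by (auto simp: t_disjoint_def t_intersecting_def)
          qed
        next
          show "2 * card (S - W) \<le> m + 1" using cS S(3) T assms(3) t_pos by linarith
        qed
      qed
    qed (use F_sub G_sub T assms t_pos k_eq in auto)
    moreover have "superfamily ?G ?T = {G\<in>\<G>. w \<notin> G \<and> ?T \<subseteq> G}" by auto
    ultimately show "card {G\<in>\<G>. w \<notin> G \<and> ?T \<subseteq> G} \<le> V" using T k_eq by (simp add: V_def)
  qed
  also have "\<dots> \<le> t * s + t * V" using t_pos by simp
  also have "\<dots> = t * (s + V)" by (simp only: distrib_left)
  also have "\<dots> \<le> t * U j"
  proof (rule mult_le_mono2)
    have "s * (1 + (\<Sum>i<j. (m + 1) ^ i)) \<le> s * (2 * (m + 1) ^ (j - 1))"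
      using m_ge assms by (intro mult_le_mono2 sum_power_le) auto
    then show "s + V \<le> U j" using assms by (simp add: V_def U_def algebra_simps)
  qed
  finally show ?thesis .
qed

text \<open>Taking \<open>j\<close> near (m + 1)/2 gives |B| \<le> (N + s)/8^j, since 2(t + 1)^2 is
  at least 8 in each step and at least 8t in one of them. This exponential gain outweighs the factor
  m + 1.\<close>

lemma card_B_small: "8 * ((m + 1) * card B) \<le> 3 * (N + s)"
proof -
  define j where "j = (m + 1) div 2"
  have j: "0 < j" "j \<le> m" "2 * j \<le> m + 1" "m + 1 \<le> 2 * j + 1" using m_ge by (auto simp: j_def)
  \<comment> \<open>Equality holds at i = 1, which fixes the constant 3.\<close>
  have pow: "8 * (2 * i + 1) \<le> 3 * 8 ^ i" if "0 < i" for i :: nat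
    using that by (induction i rule: nat_induct_non_zero) auto
  have "t * 8 ^ j \<le> (2 * (t + 1)^2) ^ j"
  proof -
    have "8 ^ (j - 1) \<le> (2 * (t + 1)^2) ^ (j - 1)" using t_sq(1) by (intro power_mono) auto
    moreover have "t * 8 \<le> 2 * (t + 1)^2" using t_sq(3) by simp
    ultimately have "8 ^ (j - 1) * (t * 8) \<le> (2 * (t + 1)^2) ^ (j - 1) * (2 * (t + 1)^2)"
      by (rule mult_le_mono)
    also have "\<dots> = (2 * (t + 1)^2) ^ j" using j(1) by (rule power_minus_mult)
    also have "8 ^ (j - 1) * (t * 8) = t * (8 ^ (j - 1) * 8)" by (simp only: mult_ac)
    also have "8 ^ (j - 1) * 8 = (8 :: nat) ^ j" using j(1) by (rule power_minus_mult)
    finally show ?thesis .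
  qed
  then have "t * 8 ^ j * U j \<le> (2 * (t + 1)^2) ^ j * U j" by (rule mult_le_mono1)
  then have 1: "8 ^ j * (t * U j) \<le> N + s" using U_power[OF j(2)] by (simp only: mult_ac)
  have "8 * ((m + 1) * card B) \<le> 8 * ((2 * j + 1) * card B)"
    using j(4) by (intro mult_le_mono1 mult_le_mono2)
  also have "\<dots> = 8 * (2 * j + 1) * card B" by (simp only: mult.assoc)
  also have "\<dots> \<le> 3 * 8 ^ j * (t * U j)"
    using pow[OF j(1)] card_B_le_U[OF j(1-3)] by (rule mult_le_mono)
  also have "\<dots> = 3 * (8 ^ j * (t * U j))" by (simp only: mult.assoc)
  also have "\<dots> \<le> 3 * (N + s)" using 1 by (rule mult_le_mono2)
  finally show ?thesis .
qed

lemma unique_trace: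
  assumes G: "G1 \<in> B" "G2 \<in> B" and Y: "Y1 \<subseteq> G1 - W" "Y2 \<subseteq> G2 - W" "card Y1 = m + 1" "card Y2 = m + 1"
  shows "Y1 = Y2"
proof (rule ccontr)
  assume ne: "Y1 \<noteq> Y2"
  have GG: "G1 \<in> \<G>" "G2 \<in> \<G>" using G by (auto simp: B_def)
  have "card \<F> + c0 + d0 \<le> N + 2 * s"
  proof (rule card_hitting_two_le[OF F_H1 W_sub W(2) _ _ Y(3,4) ne])
    show "Y1 \<subseteq> {1..n} - W" "Y2 \<subseteq> {1..n} - W" using Y(1,2) G_D GG by blast+
    show "card {F\<in>\<F>. F \<inter> Y1 = {}} \<le> s" "card {F\<in>\<F>. F \<inter> Y2 = {}} \<le> s"
      using few_miss[OF GG(1), of Y1] few_miss[OF GG(2), of Y2] Y by blast+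
  qed
  then show False
    by (rule two_traces_contradiction[OF _ N_lower N_upper d0_ge Q_ge N_ge s_pos main_term_le card_G_le card_B_small])
qed

text \<open>Uniqueness of traces puts all of \<open>B\<close> into one X = W \<union> Y. Then |\<F>|
  and |\<G>| are at most the sizes in the extremal pair, and \<open>product_ge\<close> turns both
  bounds into equalities, which determine the two families.\<close>

lemma extremal_structure:
  "\<exists>X \<in> nsets {1..n} (k + 1). \<exists>W \<in> nsets X t. \<exists>\<A> \<B>.
     \<F> = H1 {1..n} W k - \<A> \<and> \<G> = H1 {1..n} W k \<union> \<B> \<and> \<A> \<subseteq> H2 n X W k \<and>
     int (card \<A>) = int ((n - k - 1) choose (k - t)) - int s \<and>
     \<B> \<subseteq> nsets X k - H1 X W k \<and> card \<B> = min t s"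
proof -
  obtain F0 G0 where FG: "F0 \<in> \<F>" "G0 \<in> \<G>" "t_disjoint t F0 G0" by (rule obtain_t_disjoint)
  have "G0 \<in> B" using FG not_t_disjoint_if_subset[OF _ W(2) WF, of F0 G0] F_D by (auto simp: B_def)
  have ge: "m + 1 \<le> card (G - W)" if "G \<in> B" for G
  proof -
    have "G \<inter> W \<subset> W" using that by (auto simp: B_def)
    then have "card (G \<inter> W) < t" using W psubset_card_mono by metis
    moreover have "finite G" "card G = k" using that G_D by (auto simp: B_def)
    ultimately show ?thesis using k_eq by (simp add: card_Diff_subset_Int)
  qed
  obtain Y where Y: "Y \<subseteq> G0 - W" "card Y = m + 1" "finite Y"
    using ge[OF \<open>G0 \<in> B\<close>] by (meson obtain_subset_with_card_n)
  have GY: "G - W = Y" if GB: "G \<in> B" for G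
  proof -
    obtain Y' where Y': "Y' \<subseteq> G - W" "card Y' = m + 1" using ge[OF GB] by (meson obtain_subset_with_card_n)
    then have "Y' = Y" using unique_trace[OF GB \<open>G0 \<in> B\<close>] Y by blast
    \<comment> \<open>Exchanging a point of \<open>Y\<close> for a further point \<open>y\<close> of
      G - W would produce a second trace.\<close>
    have "y \<in> Y" if "y \<in> G - W" for y
    proof (rule ccontr)
      assume "y \<notin> Y"
      obtain u where u: "u \<in> Y" using Y by fastforce
      have "card (insert y (Y - {u})) = m + 1" using Y u \<open>y \<notin> Y\<close> by simp
      then have "insert y (Y - {u}) = Y"
        using unique_trace[OF GB \<open>G0 \<in> B\<close>, of "insert y (Y - {u})" Y] Y' \<open>Y' = Y\<close> that Y by blast
      then show False using \<open>y \<notin> Y\<close> by blast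
    qed
    then show ?thesis using Y' \<open>Y' = Y\<close> by blast
  qed
  define X where "X = W \<union> Y"
  have YW: "Y \<inter> W = {}" using Y by auto
  have Xsub: "X \<subseteq> {1..n}" using W_sub Y G_D[OF FG(2)] by (auto simp: X_def)
  have cX: "card X = k + 1" "finite X" using W Y YW k_eq by (auto simp: X_def card_Un_disjoint Int_commute)
  define H K where "H = H1 {1..n} W k" and "K = H2 n X W k"
  have KH: "K \<subseteq> H" unfolding H_def K_def by (rule H2_subset_H1)
  have finH: "finite H" "finite K" using KH finite_H1 finite_subset unfolding H_def by (metis finite_atLeastAtMost)+
  have cards: "card H = N" "card K = c0"
    using card_H1_full[OF W_sub W(2)] card_H2_full[of W X] Xsub cX W(2) by (auto simp: H_def K_def X_def)
  have FH: "\<F> \<subseteq> H" using F_H1 by (simp add: H_def)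
  have GH: "\<G> \<subseteq> H \<union> B" using G_sub by (auto simp: H_def H1_def B_def)
  have BX: "B \<subseteq> nsets X k - H1 X W k"
  proof
    fix G assume G: "G \<in> B"
    then have "G \<subseteq> X" using GY[OF G] by (auto simp: X_def)
    moreover have "finite G" "card G = k" "\<not> W \<subseteq> G" using G G_D by (auto simp: B_def)
    ultimately show "G \<in> nsets X k - H1 X W k" by (simp add: nsets_def H1_def)
  qed
  \<comment> \<open>A \<open>k\<close>-subset of the (k + 1)-set \<open>X\<close> that misses
    \<open>w\<close> can only be X - {w}; hence |B| \<le> t.\<close>
  have "B \<subseteq> (\<lambda>w. X - {w}) ` W"
  proof
    fix G assume G: "G \<in> B"
    then obtain w where w: "w \<in> W" "w \<notin> G" by (auto simp: B_def)
    have "G \<subseteq> X - {w}" "card G = k" using G BX w by (auto simp: nsets_def)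
    moreover have "card (X - {w}) = k" using w cX by (simp add: X_def)
    ultimately have "G = X - {w}" using cX by (intro card_subset_eq) auto
    then show "G \<in> (\<lambda>w. X - {w}) ` W" using w by blast
  qed
  then have Bt: "card B \<le> t" using W surj_card_le by blast
  have FK: "t_disjoint t F G" if "F \<in> \<F>" "F \<inter> Y = {}" "G \<in> B" for F G
    using that t_disjoint_if_misses[of G k Y t F] GY[OF that(3)] Y G_D[of G] t_pos k_eq by (auto simp: B_def)
  \<comment> \<open>\<open>G0\<close> has t - 1 elements in \<open>W\<close>, all of them in
    \<open>F0\<close>, so one common point in \<open>Y\<close> would make the two sets
    \<open>t\<close>-intersecting. Thus \<open>F0\<close> is \<open>t\<close>-disjoint from every
    member of \<open>B\<close>, which bounds |B| by \<open>s\<close>.\<close>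
  have F0Y: "F0 \<inter> Y = {}"
  proof (rule ccontr)
    assume "F0 \<inter> Y \<noteq> {}"
    then obtain y where y: "y \<in> F0" "y \<in> Y" by auto
    have "G0 \<inter> Y = Y" "finite G0" "card G0 = k" using GY[OF \<open>G0 \<in> B\<close>] G_D[OF FG(2)] by auto
    then have "card (G0 - Y) = t - 1" using Y k_eq by (simp add: card_Diff_subset_Int)
    moreover have "G0 - Y = G0 \<inter> W" using GY[OF \<open>G0 \<in> B\<close>] Y by auto
    ultimately have "card (G0 \<inter> W) = t - 1" by simp
    then have "card (insert y (G0 \<inter> W)) = t" using y Y W t_pos by (subst card_insert_disjoint) auto
    moreover have "card (insert y (G0 \<inter> W)) \<le> card (F0 \<inter> G0)"
      using y Y WF[OF FG(1)] F_D[OF FG(1)] by (intro card_mono) auto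
    ultimately show False using FG by (simp add: t_disjoint_def t_intersecting_def)
  qed
  have Bs: "card B \<le> s"
  proof -
    have "B \<subseteq> {G\<in>\<G>. t_disjoint t F0 G}" using FK[OF FG(1) F0Y] by (auto simp: B_def)
    then have "card B \<le> card {G\<in>\<G>. t_disjoint t F0 G}" using fin by (intro card_mono) auto
    also have "\<dots> \<le> s" using halves(1) FG by (auto simp: almost_half_def)
    finally show ?thesis .
  qed
  have FKs: "card (\<F> \<inter> K) \<le> s"
  proof -
    have "\<F> \<inter> K \<subseteq> {F\<in>\<F>. F \<inter> Y = {}}" using YW by (auto simp: K_def H2_def X_def)
    then have "card (\<F> \<inter> K) \<le> card {F\<in>\<F>. F \<inter> Y = {}}" using fin by (intro card_mono) auto
    also have "\<dots> \<le> s" using few_miss[OF FG(2), of Y] Y by auto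
    finally show ?thesis .
  qed
  have finB: "finite B" using fin by (auto simp: B_def)
  have HB: "H \<inter> B = {}" by (auto simp: H_def H1_def B_def)
  have cHK: "card (H - K) = N - c0" using finH KH cards by (simp add: card_Diff_subset)
  have c0N: "c0 \<le> N" using card_mono[OF finH(1) KH] cards by simp
  have Fsplit: "\<F> = (\<F> - K) \<union> (\<F> \<inter> K)" by auto
  have cF: "card \<F> = card (\<F> - K) + card (\<F> \<inter> K)"
    using fin by (subst Fsplit, subst card_Un_disjoint) auto
  have FKH: "\<F> - K \<subseteq> H - K" using FH by auto
  then have "card (\<F> - K) \<le> N - c0" using finH cHK by (metis card_mono finite_Diff)
  then have Fle: "card \<F> \<le> N - c0 + s" using cF FKs by linarith
  have "card \<G> \<le> card (H \<union> B)" using GH finH finB by (intro card_mono) auto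
  also have cHB: "card (H \<union> B) = N + card B" using finH finB HB cards by (simp add: card_Un_disjoint)
  finally have Gle: "card \<G> \<le> N + card B" .
  then have Gle': "card \<G> \<le> N + min t s" using Bt Bs by linarith
  have pos: "0 < N - c0 + s" "0 < N + min t s" using s_pos t_pos by simp_all
  \<comment> \<open>Both upper bounds are positive, so a strict loss in either factor makes the
    product strictly smaller.\<close>
  have Feq: "card \<F> = N - c0 + s"
  proof (rule ccontr)
    assume "card \<F> \<noteq> N - c0 + s"
    then have "card \<F> < N - c0 + s" using Fle by simp
    then have "card \<F> * card \<G> < (N - c0 + s) * (N + min t s)"
      using Gle' pos by (metis le_less_trans mult_le_mono2 mult_less_mono1)
    then show False using product_ge by simp
  qed
  have "card \<G> = N + min t s"
  proof (rule ccontr)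
    assume "card \<G> \<noteq> N + min t s"
    then have "card \<G> < N + min t s" using Gle' by simp
    then have "card \<F> * card \<G> < (N - c0 + s) * (N + min t s)"
      unfolding Feq using pos by (intro mult_less_mono2)
    then show False using product_ge by simp
  qed
  then have cB: "card B = min t s" "card \<G> = card (H \<union> B)"
    using Gle Bt Bs cHB by linarith+
  have Geq: "\<G> = H \<union> B" using card_subset_eq[OF _ GH] finH finB cB(2) by simp
  have "card (\<F> - K) = N - c0"
    using cF Feq FKs \<open>card (\<F> - K) \<le> N - c0\<close> by linarith
  then have "\<F> - K = H - K" using card_subset_eq[OF _ FKH] finH cHK by simp
  then have AK: "H - \<F> \<subseteq> K" by blast
  have "card (H - \<F>) = N - (N - c0 + s)" using FH fin cards Feq by (simp add: card_Diff_subset)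
  moreover have "x - (x - c + s) = c - s" if "c \<le> x" for x c :: nat using that by linarith
  ultimately have cA: "card (H - \<F>) = c0 - s" using c0N by metis
  have "X \<in> nsets {1..n} (k + 1)" "W \<in> nsets X t"
    using Xsub cX W by (auto simp: nsets_def X_def)
  moreover have "\<F> = H - (H - \<F>)" using FH by blast
  \<comment> \<open>By \<open>c0_ge\<close> the natural difference is not truncated and agrees with
    the integer one.\<close>
  moreover have "int (card (H - \<F>)) = int ((n - k - 1) choose (k - t)) - int s"
    using cA c0_ge k_eq by (simp add: of_nat_diff)
  ultimately show ?thesis
    using Geq AK BX cB(1) unfolding H_def K_def by blast
qed

end

theorem theorem1p2:
  fixes n k t s :: nat and \<F> \<G> :: "nat set set"
  assumes "n > 0" "k > 0" "t > 0" "s > 0"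
    and "k \<ge> t + 2"
    and "n \<ge> (t + 1)^2 * (2 * (k - t + 1)^2 + 7 * s)"
    and "admissible_pair n k t s \<F> \<G>"
    and "\<forall>\<F>' \<G>'. admissible_pair n k t s \<F>' \<G>' \<longrightarrow>
           card \<F>' * card \<G>' \<le> card \<F> * card \<G>"
  shows "\<exists>X \<in> nsets {1..n} (k + 1). \<exists>W \<in> nsets X t. \<exists>\<A> \<B>.
           \<F> = H1 {1..n} W k - \<A> \<and>
           \<G> = H1 {1..n} W k \<union> \<B> \<and>
           \<A> \<subseteq> H2 n X W k \<and>
           int (card \<A>) = int ((n - k - 1) choose (k - t)) - int s \<and>
           \<B> \<subseteq> nsets X k - H1 X W k \<and>
           card \<B> = min t s"
proof -
  interpret large_ground_set n k t s "k - t"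
    using assms by unfold_locales auto
  obtain \<F>' \<G>' where "admissible_pair n k t s \<F>' \<G>'" "card \<F>' = N - c0 + s" "card \<G>' = N + min t s"
    using extremal_pair_exists by blast
  then have "(N - c0 + s) * (N + min t s) \<le> card \<F> * card \<G>" using assms(8) by metis
  then interpret maximal_pair n k t s "k - t" \<F> \<G>
    using assms(7) by unfold_locales (auto simp: admissible_pair_def almost_cross_iff_halves)
  obtain W z where "finite W" "card W = t" "z \<notin> W" "\<And>F. F \<in> \<F> \<Longrightarrow> W \<subseteq> F"
    "almost_cover s t \<G> (insert z W)" "\<And>w. w \<in> W \<Longrightarrow> \<exists>F\<in>\<F>. \<not> insert z W - {w} \<subseteq> F"
    by (rule obtain_kernel) blast
  then interpret maximal_pair_kernel n k t s "k - t" \<F> \<G> W z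
    by unfold_locales
  show ?thesis by (rule extremal_structure)
qed

end
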